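(* Let $K\subset\mathbb{R}^2$ be any compact set and let $u\in C^2_c(\mathbb{R}^2;\mathbb{R}^2)$ with $\operatorname{div}u=0$, $u=0$ and $\nabla u=0$ on $K$. Then there exists a sequence $\{u_k\}_k\subset C^\infty_c(\mathbb{R}^2;\mathbb{R}^2)$ with $\operatorname{div}u_k=0$ and $\operatorname{supp}u_k\subset\mathbb{R}^2\setminus K$, such that $u_k\to u$ in $C^1$. *)

theory Defs
  imports "HOL-Analysis.Analysis"
begin

fun Ck_scalar :: "nat \<Rightarrow> (real^'n \<Rightarrow> real) \<Rightarrow> bool" where
  "Ck_scalar 0 g = continuous_on UNIV g"
| "Ck_scalar (Suc k) g = (g differentiable_on UNIV \<and>
      (\<forall>j. Ck_scalar k (\<lambda>x. frechet_derivative g (at x) (axis j 1))))"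

definition Ck :: "nat \<Rightarrow> (real^'n \<Rightarrow> real^'m) \<Rightarrow> bool" where
  "Ck k f = (\<forall>i. Ck_scalar k (\<lambda>x. f x $ i))"

definition C_infinity :: "(real^'n \<Rightarrow> real^'m) \<Rightarrow> bool" where
  "C_infinity f = (\<forall>k. Ck k f)"

definition supp :: "(real^'n \<Rightarrow> real^'m) \<Rightarrow> (real^'n) set" where
  "supp f = closure {x. f x \<noteq> 0}"

definition divergence :: "(real^'n \<Rightarrow> real^'n) \<Rightarrow> real^'n \<Rightarrow> real" where
  "divergence u x = trace (jacobian u (at x))"

end

theory Submission
  imports Defs "HOL-Computational_Algebra.Polynomial"
begin

text \<open>
Write \<open>u = (\<partial>\<^sub>2 \<psi>, - \<partial>\<^sub>1 \<psi>)\<close> with a compactly supported stream function \<open>\<psi>\<close> of class \<open>C\<^sup>3\<close>. It suffices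
to approximate \<open>\<psi>\<close> in \<open>C\<^sup>2\<close> by smooth functions that are locally constant near \<open>K\<close>. The difficulty
is that \<open>\<psi>\<close> may take infinitely many values on \<open>K\<close>. Since \<open>D \<psi>\<close> and \<open>D\<^sup>2 \<psi>\<close> vanish on \<open>K\<close>, \<open>\<psi>\<close>
oscillates by only \<open>O(r\<^sup>3)\<close> on a ball of radius \<open>r\<close> around a point of \<open>K\<close>; as the dimension is less
than 3, the image of \<open>K\<close> under \<open>\<psi>\<close> is covered by finitely many intervals of arbitrarily small total
length, and a 1-Lipschitz function \<open>h\<close> that is uniformly close to the identity collapses each of
them to a point.

Composing with \<open>h\<close> destroys the second derivatives of \<open>\<psi>\<close>, but \<open>H = h \<circ> \<psi>\<close> inherits the cubic
oscillation bound at \<open>K\<close>. We start from a smoothing of \<open>\<psi>\<close>, obtained by gluing its quadratic Taylor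
polynomials at the nodes of a grid of mesh \<open>r\<close>, and run through the scales \<open>r\<^sub>k = r / (4 n + 1)\<^sup>k\<close>:
at distance at most about \<open>r\<^sub>k\<close> from \<open>K\<close> the current approximation is replaced by the
quasi-interpolant of \<open>H\<close> on a grid of mesh \<open>r\<^sub>k\<close>. Both are within \<open>O(r\<^sub>k\<^sup>3)\<close> of a constant there, so
the second derivatives change by \<open>O(r\<^sub>k)\<close>, and these changes sum to \<open>O(r)\<close>. After finitely many
steps the mesh is so fine that the quasi-interpolant of \<open>H\<close> is locally constant near \<open>K\<close>.
\<close>

section \<open>Partial derivatives\<close>

definition partial_deriv :: "'n \<Rightarrow> (real^'n \<Rightarrow> real) \<Rightarrow> real^'n \<Rightarrow> real" ("\<partial>") where
  "\<partial> j f = (\<lambda>x. frechet_derivative f (at x) (axis j 1))"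

lemma partial_deriv_eqI: "(f has_derivative f') (at x) \<Longrightarrow> \<partial> j f x = f' (axis j 1)"
  unfolding partial_deriv_def by (metis frechet_derivative_at)

lemma has_derivative_partial_deriv:
  fixes f :: "real^'n \<Rightarrow> real"
  assumes "f differentiable at x"
  shows "(f has_derivative (\<lambda>h. \<Sum>j\<in>UNIV. h $ j * \<partial> j f x)) (at x)"
proof -
  have deriv: "(f has_derivative frechet_derivative f (at x)) (at x)"
    using assms frechet_derivative_works by blast
  then have lin: "linear (frechet_derivative f (at x))"
    using has_derivative_linear by blast
  have "frechet_derivative f (at x) h = (\<Sum>j\<in>UNIV. h $ j * \<partial> j f x)" for h
  proof -
    have "frechet_derivative f (at x) h = frechet_derivative f (at x) (\<Sum>j\<in>UNIV. h $ j *\<^sub>R axis j 1)"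
      by (simp only: vector_matrix_mul_rid basis_expansion flip: scalar_mult_eq_scaleR)
    then show ?thesis
      by (simp add: linear_sum[OF lin] linear_scale[OF lin] partial_deriv_def)
  qed
  then show ?thesis using deriv by presburger
qed

lemma partial_deriv_const [simp]: "\<partial> j (\<lambda>x. c) = (\<lambda>x. 0)"
  by (rule ext) (rule partial_deriv_eqI[OF has_derivative_const])

lemma partial_deriv_add:
  assumes "f differentiable at x" "g differentiable at x"
  shows "\<partial> j (\<lambda>x. f x + g x) x = \<partial> j f x + \<partial> j g x"
  using partial_deriv_eqI[OF has_derivative_add[OF assms[unfolded frechet_derivative_works]], of j]
  by (simp add: partial_deriv_def)

lemma partial_deriv_mult:
  assumes "f differentiable at x" "g differentiable at x"
  shows "\<partial> j (\<lambda>x. f x * g x) x = \<partial> j f x * g x + f x * \<partial> j g x"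
  using partial_deriv_eqI[OF has_derivative_mult[OF assms[unfolded frechet_derivative_works]], of j]
  by (simp add: partial_deriv_def)

lemma partial_deriv_cmult:
  assumes "f differentiable at x"
  shows "\<partial> j (\<lambda>x. c * f x) x = c * \<partial> j f x"
  using partial_deriv_mult[OF _ assms, of "\<lambda>_. c"] by simp

lemma partial_deriv_minus:
  assumes "f differentiable at x"
  shows "\<partial> j (\<lambda>x. - f x) x = - \<partial> j f x"
  using partial_deriv_cmult[OF assms, of j "-1"] by simp

lemma partial_deriv_diff:
  assumes "f differentiable at x" "g differentiable at x"
  shows "\<partial> j (\<lambda>x. f x - g x) x = \<partial> j f x - \<partial> j g x"
  using partial_deriv_add[OF assms(1), of "\<lambda>x. - g x" j] assms by (simp add: partial_deriv_minus)

lemma partial_deriv_inverse: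
  assumes "f differentiable at x" "f x \<noteq> 0"
  shows "\<partial> j (\<lambda>x. inverse (f x)) x = - (\<partial> j f x * (inverse (f x) * inverse (f x)))"
  using partial_deriv_eqI[OF Deriv.has_derivative_inverse[
    OF assms(2) assms(1)[unfolded frechet_derivative_works]], of j]
  by (simp add: partial_deriv_def)

lemma partial_deriv_affine:
  fixes f :: "real^'n \<Rightarrow> real"
  assumes "f differentiable at (a *\<^sub>R x + v)"
  shows differentiable_affine: "(\<lambda>x. f (a *\<^sub>R x + v)) differentiable at x"
    and "\<partial> j (\<lambda>x. f (a *\<^sub>R x + v)) x = a * \<partial> j f (a *\<^sub>R x + v)"
proof -
  let ?D = "frechet_derivative f (at (a *\<^sub>R x + v))"
  have f: "(f has_derivative ?D) (at (a *\<^sub>R x + v))"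
    using assms frechet_derivative_works by blast
  then have chain: "((\<lambda>x. f (a *\<^sub>R x + v)) has_derivative (\<lambda>h. ?D (a *\<^sub>R h))) (at x)"
    by (intro has_derivative_compose[of "\<lambda>x. a *\<^sub>R x + v" "\<lambda>h. a *\<^sub>R h" x UNIV f ?D])
       (auto intro!: derivative_eq_intros)
  then show "(\<lambda>x. f (a *\<^sub>R x + v)) differentiable at x"
    using differentiable_def by blast
  have "linear ?D" using f has_derivative_linear by blast
  then show "\<partial> j (\<lambda>x. f (a *\<^sub>R x + v)) x = a * \<partial> j f (a *\<^sub>R x + v)"
    using partial_deriv_eqI[OF chain, of j] by (simp add: linear_scale partial_deriv_def)
qed

lemma partial_deriv_coordinate:
  fixes x :: "real^'n"
  assumes "(g has_real_derivative g') (at (x $ i))"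
  shows differentiable_coordinate: "(\<lambda>x. g (x $ i)) differentiable at x"
    and "\<partial> j (\<lambda>x. g (x $ i)) x = (if i = j then g' else 0)"
proof -
  have chain: "((\<lambda>x. g (x $ i)) has_derivative (\<lambda>h. g' * h $ i)) (at x)"
    using assms by (intro has_derivative_compose[of "\<lambda>x. x $ i" "\<lambda>h. h $ i" x UNIV g "\<lambda>h. g' * h"])
      (auto simp: has_field_derivative_def
        intro!: bounded_linear_imp_has_derivative bounded_linear_vec_nth)
  then show "(\<lambda>x. g (x $ i)) differentiable at x"
    using differentiable_def by blast
  show "\<partial> j (\<lambda>x. g (x $ i)) x = (if i = j then g' else 0)"
    using partial_deriv_eqI[OF chain, of j] by (simp add: axis_def)
qed

lemma partial_deriv_cong_open:
  assumes "open S" "x \<in> S" "\<And>y. y \<in> S \<Longrightarrow> f y = g y"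
  shows "\<partial> j f x = \<partial> j g x"
proof -
  have "(f has_derivative D) (at x) \<longleftrightarrow> (g has_derivative D) (at x)" for D
    using has_derivative_transform_within_open[OF _ assms(1,2), of f D UNIV g]
      has_derivative_transform_within_open[OF _ assms(1,2), of g D UNIV f] assms(3) by auto
  then show ?thesis by (simp add: partial_deriv_def frechet_derivative_def)
qed

lemma partial_deriv_support_subset:
  "{x. \<partial> j f x \<noteq> 0} \<subseteq> closure {x. f x \<noteq> 0}"
proof
  fix x assume x: "x \<in> {x. \<partial> j f x \<noteq> 0}"
  show "x \<in> closure {x. f x \<noteq> 0}"
  proof (rule ccontr)
    assume "x \<notin> closure {x. f x \<noteq> 0}"
    then have "\<partial> j f x = \<partial> j (\<lambda>_. 0) x"
      using closure_subset[of "{x. f x \<noteq> 0}"]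
      by (intro partial_deriv_cong_open[of "- closure {x. f x \<noteq> 0}"]) auto
    with x show False by simp
  qed
qed

lemma bounded_support_partial_deriv:
  "bounded {x. f x \<noteq> 0} \<Longrightarrow> bounded {x. \<partial> j f x \<noteq> 0}"
  by (rule bounded_subset[OF bounded_closure partial_deriv_support_subset])

lemma has_real_derivative_along_axis:
  fixes f :: "real^'n \<Rightarrow> real"
  assumes "f differentiable at (x + t *\<^sub>R axis i 1)"
  shows "((\<lambda>t. f (x + t *\<^sub>R axis i 1)) has_real_derivative \<partial> i f (x + t *\<^sub>R axis i 1)) (at t)"
proof -
  let ?D = "frechet_derivative f (at (x + t *\<^sub>R axis i 1))"
  have f: "(f has_derivative ?D) (at (x + t *\<^sub>R axis i 1))"
    using assms frechet_derivative_works by blast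
  have "((\<lambda>t. f (x + t *\<^sub>R axis i 1)) has_derivative (\<lambda>h. ?D (h *\<^sub>R axis i 1))) (at t)"
    by (rule has_derivative_compose[of "\<lambda>t. x + t *\<^sub>R axis i 1" "\<lambda>h. h *\<^sub>R axis i 1" t UNIV f,
        OF _ f])
       (auto intro!: derivative_eq_intros)
  moreover have "(\<lambda>h. ?D (h *\<^sub>R axis i 1)) = (*) (\<partial> i f (x + t *\<^sub>R axis i 1))"
    using has_derivative_linear[OF f] by (auto simp: linear_scale partial_deriv_def)
  ultimately show ?thesis
    by (simp add: has_field_derivative_def)
qed

lemma lipschitz_on_partial_deriv:
  fixes f :: "real^'n \<Rightarrow> real" and B :: real
  assumes "convex S" "0 \<le> B"
    and diff: "\<And>x. x \<in> S \<Longrightarrow> f differentiable at x" and le: "\<And>x j. x \<in> S \<Longrightarrow> \<bar>\<partial> j f x\<bar> \<le> B"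
  shows "(CARD('n) * B)-lipschitz_on S f"
proof (rule bounded_derivative_imp_lipschitz)
  show "(f has_derivative (\<lambda>h. \<Sum>j\<in>UNIV. h $ j * \<partial> j f x)) (at x within S)" if "x \<in> S" for x
    using has_derivative_partial_deriv[OF diff[OF that]] has_derivative_at_withinI by blast
  show "onorm (\<lambda>h. \<Sum>j\<in>UNIV. h $ j * \<partial> j f x) \<le> CARD('n) * B" if "x \<in> S" for x
  proof (rule onorm_le)
    fix h :: "real^'n"
    have "norm (\<Sum>j\<in>UNIV. h $ j * \<partial> j f x) \<le> (\<Sum>j\<in>(UNIV :: 'n set). norm h * B)"
      using le[OF that] component_le_norm_cart[of h]
      by (intro sum_norm_le) (auto simp: abs_mult intro!: mult_mono)
    then show "norm (\<Sum>j\<in>UNIV. h $ j * \<partial> j f x) \<le> CARD('n) * B * norm h"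
      by (simp add: mult.commute mult.left_commute)
  qed
qed (use assms in auto)

section \<open>Functions of class \<open>C\<^sup>k\<close>\<close>

declare Ck_scalar.simps(2) [simp del]

lemma Ck_scalar_Suc:
  "Ck_scalar (Suc k) f \<longleftrightarrow> (\<forall>x. f differentiable at x) \<and> (\<forall>j. Ck_scalar k (\<partial> j f))"
  by (auto simp: Ck_scalar.simps(2) partial_deriv_def differentiable_on_def)

abbreviation smooth :: "(real^'n \<Rightarrow> real) \<Rightarrow> bool" where
  "smooth f \<equiv> \<forall>k. Ck_scalar k f"

lemma Ck_scalar_continuous: "Ck_scalar k f \<Longrightarrow> continuous_on UNIV f"
  by (cases k) (auto simp: Ck_scalar_Suc
      intro!: continuous_at_imp_continuous_on differentiable_imp_continuous_within)

lemma Ck_scalar_SucD: "Ck_scalar (Suc k) f \<Longrightarrow> Ck_scalar k f"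
  by (induction k arbitrary: f) (auto simp: Ck_scalar_Suc
      intro: Ck_scalar_continuous[of "Suc 0", unfolded Ck_scalar_Suc])

lemma Ck_scalar_mono: "Ck_scalar k f \<Longrightarrow> l \<le> k \<Longrightarrow> Ck_scalar l f"
  by (induction k) (auto simp: le_Suc_eq dest: Ck_scalar_SucD)

lemma Ck_scalar_1D:
  assumes "Ck_scalar 1 f"
  shows "f differentiable at x" "continuous_on UNIV (\<partial> j f)"
  using assms by (auto simp: One_nat_def Ck_scalar_Suc)

lemma Ck_scalar_2D:
  assumes "Ck_scalar 2 f"
  shows "f differentiable at x" "\<partial> i f differentiable at x"
    "continuous_on UNIV (\<partial> i f)" "continuous_on UNIV (\<partial> j (\<partial> i f))"
  using assms by (auto simp: numeral_2_eq_2 Ck_scalar_Suc intro: Ck_scalar_continuous[of "Suc 0"])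

lemma Ck_scalar_const: "Ck_scalar k (\<lambda>x. c)"
  by (induction k arbitrary: c) (auto simp: Ck_scalar_Suc)

lemma Ck_scalar_add: "Ck_scalar k f \<Longrightarrow> Ck_scalar k g \<Longrightarrow> Ck_scalar k (\<lambda>x. f x + g x)"
proof (induction k arbitrary: f g)
  case (Suc k)
  then have "\<partial> j (\<lambda>x. f x + g x) = (\<lambda>x. \<partial> j f x + \<partial> j g x)" for j
    by (auto simp: Ck_scalar_Suc partial_deriv_add)
  with Suc show ?case by (auto simp: Ck_scalar_Suc)
qed (simp add: continuous_on_add)

lemma Ck_scalar_mult: "Ck_scalar k f \<Longrightarrow> Ck_scalar k g \<Longrightarrow> Ck_scalar k (\<lambda>x. f x * g x)"
proof (induction k arbitrary: f g)
  case (Suc k)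
  then have "\<partial> j (\<lambda>x. f x * g x) = (\<lambda>x. \<partial> j f x * g x + f x * \<partial> j g x)" for j
    by (auto simp: Ck_scalar_Suc partial_deriv_mult)
  moreover have "Ck_scalar k f" "Ck_scalar k g" using Suc.prems by (auto intro: Ck_scalar_SucD)
  ultimately show ?case using Suc by (auto simp: Ck_scalar_Suc intro!: Ck_scalar_add)
qed (simp add: continuous_on_mult)

lemma Ck_scalar_minus: "Ck_scalar k f \<Longrightarrow> Ck_scalar k (\<lambda>x. - f x)"
  using Ck_scalar_mult[OF Ck_scalar_const[of k "-1"], of f] by simp

lemma Ck_scalar_diff: "Ck_scalar k f \<Longrightarrow> Ck_scalar k g \<Longrightarrow> Ck_scalar k (\<lambda>x. f x - g x)"
  using Ck_scalar_add[OF _ Ck_scalar_minus, of k f g] by simp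

lemma Ck_scalar_sum: "(\<And>p. p \<in> I \<Longrightarrow> Ck_scalar k (f p)) \<Longrightarrow> Ck_scalar k (\<lambda>x. \<Sum>p\<in>I. f p x)"
  by (induction I rule: infinite_finite_induct) (auto intro: Ck_scalar_const Ck_scalar_add)

lemma Ck_scalar_prod: "(\<And>p. p \<in> I \<Longrightarrow> Ck_scalar k (f p)) \<Longrightarrow> Ck_scalar k (\<lambda>x. \<Prod>p\<in>I. f p x)"
  by (induction I rule: infinite_finite_induct) (auto intro: Ck_scalar_const Ck_scalar_mult)

lemma Ck_scalar_inverse:
  assumes "\<And>x. f x \<noteq> 0"
  shows "Ck_scalar k f \<Longrightarrow> Ck_scalar k (\<lambda>x. inverse (f x))"
proof (induction k)
  case 0
  then show ?case using assms by (simp add: continuous_on_inverse)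
next
  case (Suc k)
  then have "\<partial> j (\<lambda>x. inverse (f x)) = (\<lambda>x. - (\<partial> j f x * (inverse (f x) * inverse (f x))))" for j
    using assms by (auto simp: Ck_scalar_Suc partial_deriv_inverse)
  moreover have "Ck_scalar k f" using Suc.prems by (auto intro: Ck_scalar_SucD)
  ultimately show ?case using Suc assms
    by (auto simp: Ck_scalar_Suc intro!: Ck_scalar_minus Ck_scalar_mult differentiable_inverse)
qed

lemma Ck_scalar_affine: "Ck_scalar k f \<Longrightarrow> Ck_scalar k (\<lambda>x. f (a *\<^sub>R x + v))"
proof (induction k arbitrary: f)
  case 0
  have "continuous_on UNIV (\<lambda>x. a *\<^sub>R x + v)" by (intro continuous_intros)
  then show ?case using 0 continuous_on_compose2[of UNIV f UNIV "\<lambda>x. a *\<^sub>R x + v"] by simp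
next
  case (Suc k)
  then have "\<partial> j (\<lambda>x. f (a *\<^sub>R x + v)) = (\<lambda>x. a * \<partial> j f (a *\<^sub>R x + v))" for j
    by (auto simp: Ck_scalar_Suc partial_deriv_affine)
  with Suc show ?case
    by (auto simp: Ck_scalar_Suc differentiable_affine intro!: Ck_scalar_mult Ck_scalar_const)
qed

lemma Ck_scalar_nth: "Ck_scalar k (\<lambda>x::real^'n. x $ i)"
proof (cases k)
  case 0
  then show ?thesis by (simp add: continuous_on_component continuous_on_id)
next
  case (Suc l)
  have deriv: "((\<lambda>t. t) has_real_derivative 1) (at t)" for t by (auto intro: derivative_eq_intros)
  have "\<partial> j (\<lambda>x::real^'n. x $ i) = (\<lambda>x. if i = j then 1 else 0)" for j
    by (intro ext) (simp add: partial_deriv_coordinate(2)[OF deriv])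
  then show ?thesis using differentiable_coordinate[OF deriv]
    by (auto simp: Suc Ck_scalar_Suc Ck_scalar_const)
qed

lemma Ck_scalar_local:
  assumes "\<And>x. \<exists>S g. open S \<and> x \<in> S \<and> Ck_scalar k g \<and> (\<forall>y\<in>S. f y = g y)"
  shows "Ck_scalar k f"
  using assms
proof (induction k arbitrary: f)
  case 0
  have "isCont f x" for x
  proof -
    obtain S g where "open S" "x \<in> S" "continuous_on UNIV g" "\<forall>y\<in>S. f y = g y"
      using "0.prems"[of x] by auto
    then show ?thesis
      using continuous_on_cong[of S S f g] continuous_on_eq_continuous_at[of S f]
        continuous_on_subset[of UNIV g S]
      by simp
  qed
  then show ?case by (simp add: continuous_at_imp_continuous_on)
next
  case (Suc k)
  have "f differentiable at x" for x
  proof -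
    obtain S g where "open S" "x \<in> S" "g differentiable at x" "\<forall>y\<in>S. f y = g y"
      using Suc.prems[of x] by (auto simp: Ck_scalar_Suc)
    then show ?thesis
      unfolding differentiable_def using has_derivative_transform_within_open[of g _ x UNIV S f]
      by auto
  qed
  moreover have "\<exists>S g. open S \<and> x \<in> S \<and> Ck_scalar k g \<and> (\<forall>y\<in>S. \<partial> j f y = g y)" for x j
  proof -
    obtain S g where S: "open S" "x \<in> S" "Ck_scalar k (\<partial> j g)" and eq: "\<forall>y\<in>S. f y = g y"
      using Suc.prems[of x] by (auto simp: Ck_scalar_Suc)
    have "\<partial> j f y = \<partial> j g y" if "y \<in> S" for y
      using partial_deriv_cong_open[OF S(1) that] eq by blast
    then show ?thesis using S by blast
  qed
  ultimately show ?case unfolding Ck_scalar_Suc by (intro conjI allI Suc.IH)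
qed

lemma second_difference_eq_mixed_partial:
  fixes f :: "real^'n \<Rightarrow> real" and i j
  assumes f: "Ck_scalar 2 f" and h: "h > 0"
  defines "e \<equiv> \<lambda>k t. t *\<^sub>R (axis k 1 :: real^'n)"
  shows "\<exists>\<xi>. dist \<xi> x \<le> 2 * h \<and>
    f (x + e i h + e j h) - f (x + e i h) - f (x + e j h) + f x = h * h * \<partial> j (\<partial> i f) \<xi>"
proof -
  let ?G = "\<lambda>s. f (x + e j h + e i s) - f (x + e i s)"
  have "\<exists>s. 0 < s \<and> s < h \<and> ?G h - ?G 0 = (h - 0) * (\<partial> i f (x + e j h + e i s) - \<partial> i f (x + e i s))"
    using h Ck_scalar_2D[OF f] unfolding e_def
    by (intro MVT2) (auto intro!: derivative_intros has_real_derivative_along_axis)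
  then obtain s where s: "0 < s" "s < h"
    "?G h - ?G 0 = h * (\<partial> i f (x + e j h + e i s) - \<partial> i f (x + e i s))" by auto
  let ?F = "\<lambda>t. \<partial> i f (x + e i s + e j t)"
  have "\<exists>t. 0 < t \<and> t < h \<and> ?F h - ?F 0 = (h - 0) * \<partial> j (\<partial> i f) (x + e i s + e j t)"
    using h Ck_scalar_2D[OF f] unfolding e_def
    by (intro MVT2) (auto intro!: has_real_derivative_along_axis)
  then obtain t where t: "0 < t" "t < h" "?F h - ?F 0 = h * \<partial> j (\<partial> i f) (x + e i s + e j t)" by auto
  have "dist (x + e i s + e j t) x \<le> \<bar>s\<bar> + \<bar>t\<bar>"
    using norm_triangle_ineq[of "e i s" "e j t"] by (simp add: e_def dist_norm)
  moreover have "f (x + e i h + e j h) - f (x + e i h) - f (x + e j h) + f x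
      = h * h * \<partial> j (\<partial> i f) (x + e i s + e j t)"
    using s(3) t(3) by (simp add: e_def algebra_simps)
  ultimately show ?thesis using s t by (intro exI[of _ "x + e i s + e j t"]) auto
qed

lemma ex_equal_mixed_partials:
  fixes f :: "real^'n \<Rightarrow> real"
  assumes "Ck_scalar 2 f" "h > 0"
  shows "\<exists>y z. dist y x \<le> h \<and> dist z x \<le> h \<and> \<partial> i (\<partial> j f) y = \<partial> j (\<partial> i f) z"
proof -
  have "h / 2 > 0" using assms(2) by simp
  from second_difference_eq_mixed_partial[OF assms(1) this, of x i j]
    second_difference_eq_mixed_partial[OF assms(1) this, of x j i]
  obtain y z where "dist y x \<le> h" "dist z x \<le> h"
    "(h / 2) * (h / 2) * \<partial> i (\<partial> j f) y = (h / 2) * (h / 2) * \<partial> j (\<partial> i f) z"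
    by (auto simp: algebra_simps)
  then show ?thesis using assms(2) by auto
qed

lemma partial_deriv_commute:
  fixes f :: "real^'n \<Rightarrow> real"
  assumes f: "Ck_scalar 2 f"
  shows "\<partial> i (\<partial> j f) x = \<partial> j (\<partial> i f) x"
proof -
  define h where "h n = inverse (real (Suc n))" for n
  have "\<exists>y z. dist y x \<le> h n \<and> dist z x \<le> h n \<and> \<partial> i (\<partial> j f) y = \<partial> j (\<partial> i f) z" for n
    using f by (intro ex_equal_mixed_partials) (auto simp: h_def)
  then obtain y z where near: "\<And>n. dist (y n) x \<le> h n" "\<And>n. dist (z n) x \<le> h n"
    and eq: "\<And>n. \<partial> i (\<partial> j f) (y n) = \<partial> j (\<partial> i f) (z n)" by metis
  have h: "h \<longlonglongrightarrow> 0" unfolding h_def by (rule LIMSEQ_inverse_real_of_nat)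
  then have lim: "y \<longlonglongrightarrow> x" "z \<longlonglongrightarrow> x"
    using near unfolding tendsto_dist_iff[of _ x]
    by (auto intro: tendsto_sandwich[OF _ _ tendsto_const h])
  have "(\<lambda>n. \<partial> i (\<partial> j f) (y n)) \<longlonglongrightarrow> \<partial> i (\<partial> j f) x" "(\<lambda>n. \<partial> j (\<partial> i f) (z n)) \<longlonglongrightarrow> \<partial> j (\<partial> i f) x"
    using continuous_on_tendsto_compose[OF Ck_scalar_2D(4)[OF f] lim(1)]
      continuous_on_tendsto_compose[OF Ck_scalar_2D(4)[OF f] lim(2)] by auto
  then show ?thesis using eq LIMSEQ_unique by simp
qed

lemma bounded_range_compact_support:
  fixes f :: "real^'n \<Rightarrow> real"
  assumes "continuous_on UNIV f" "bounded {x. f x \<noteq> 0}"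
  shows "bounded (range f)"
proof -
  have "compact (f ` closure {x. f x \<noteq> 0})"
    using assms by (intro compact_continuous_image) (auto intro: continuous_on_subset)
  moreover have "range f \<subseteq> insert 0 (f ` closure {x. f x \<noteq> 0})"
    using closure_subset[of "{x. f x \<noteq> 0}"] by auto
  ultimately show ?thesis by (meson bounded_insert bounded_subset compact_imp_bounded)
qed

lemma ex_lipschitz_compact_support:
  fixes f :: "real^'n \<Rightarrow> real"
  assumes "Ck_scalar 1 f" "bounded {x. f x \<noteq> 0}"
  shows "\<exists>L. L-lipschitz_on UNIV f"
proof -
  have "bounded (range (\<partial> j f))" for j
    by (intro bounded_range_compact_support Ck_scalar_1D(2) bounded_support_partial_deriv assms)
  then have "bounded (\<Union>j. range (\<partial> j f))" by (intro bounded_UN) auto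
  then obtain B where "0 < B" "\<And>j x. \<bar>\<partial> j f x\<bar> \<le> B" unfolding bounded_pos by auto
  then have "(CARD('n) * B)-lipschitz_on UNIV f"
    using Ck_scalar_1D(1)[OF assms(1)] by (intro lipschitz_on_partial_deriv) auto
  then show ?thesis ..
qed

section \<open>Scaled bounds on two-jets\<close>

text \<open>The weights \<open>r\<close> and \<open>r\<^sup>2\<close> are those under which the bound is stable under products.\<close>

definition jet_bound :: "real \<Rightarrow> real \<Rightarrow> (real^'n \<Rightarrow> real) \<Rightarrow> real^'n \<Rightarrow> bool" where
  "jet_bound r M f x \<longleftrightarrow> \<bar>f x\<bar> \<le> M \<and> (\<forall>i. \<bar>\<partial> i f x\<bar> * r \<le> M) \<and> (\<forall>i j. \<bar>\<partial> i (\<partial> j f) x\<bar> * r\<^sup>2 \<le> M)"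

lemma jet_boundI:
  assumes "\<bar>f x\<bar> \<le> M" "\<And>i. \<bar>\<partial> i f x\<bar> * r \<le> M" "\<And>i j. \<bar>\<partial> i (\<partial> j f) x\<bar> * (r * r) \<le> M"
  shows "jet_bound r M f x"
  using assms by (simp add: jet_bound_def power2_eq_square)

lemma jet_boundD:
  assumes "jet_bound r M f x"
  shows "\<bar>f x\<bar> \<le> M" "\<bar>\<partial> i f x\<bar> * r \<le> M" "\<bar>\<partial> i (\<partial> j f) x\<bar> * (r * r) \<le> M"
  using assms by (auto simp: jet_bound_def power2_eq_square)

lemma jet_bound_nonneg: "jet_bound r M f x \<Longrightarrow> 0 \<le> M"
  using jet_boundD(1) abs_ge_zero order_trans by blast

lemma jet_bound_0D:
  assumes "jet_bound r 0 f x" "0 < r"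
  shows "f x = 0" "\<partial> i f x = 0"
  using jet_boundD(1,2)[OF assms(1)] assms(2) by (auto simp: mult_le_0_iff)

lemma jet_bound_mono: "jet_bound r M f x \<Longrightarrow> M \<le> M' \<Longrightarrow> jet_bound r M' f x"
  unfolding jet_bound_def by (meson order_trans)

lemma jet_bound_scale:
  assumes "jet_bound r M f x" "0 \<le> s" "s \<le> r"
  shows "jet_bound s M f x"
proof -
  have "\<bar>a\<bar> * s \<le> \<bar>a\<bar> * r" "\<bar>a\<bar> * s\<^sup>2 \<le> \<bar>a\<bar> * r\<^sup>2" for a :: real
    using assms(2,3) by (auto intro!: mult_left_mono power_mono)
  with assms(1) show ?thesis unfolding jet_bound_def by (meson order_trans)
qed

lemma jet_bound_unscale:
  assumes "jet_bound r M f x" "0 < r" "r \<le> 1"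
  shows "jet_bound 1 (M / r\<^sup>2) f x"
proof -
  have r: "r\<^sup>2 \<le> 1" "r\<^sup>2 \<le> r" using assms(2,3) by (auto simp: power2_eq_square mult_le_one)
  have "\<bar>a\<bar> * r\<^sup>2 \<le> \<bar>a\<bar>" "\<bar>a\<bar> * r\<^sup>2 \<le> \<bar>a\<bar> * r" for a :: real
    using mult_left_mono[OF r(1), of "\<bar>a\<bar>"] mult_left_mono[OF r(2), of "\<bar>a\<bar>"] by auto
  with assms show ?thesis unfolding jet_bound_def
    by (auto simp: pos_le_divide_eq intro: order_trans)
qed

lemma jet_bound_unscale_cubic:
  assumes "jet_bound r (M * r ^ 3) f x" "0 < r" "r \<le> 1"
  shows "jet_bound 1 (M * r) f x"
  using jet_bound_unscale[OF assms] assms(2) by (simp add: power2_eq_square power3_eq_cube mult.assoc)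

lemma jet_bound_cong_open:
  assumes "open S" "x \<in> S" and eq: "\<And>y. y \<in> S \<Longrightarrow> f y = g y"
  shows "jet_bound r M f x \<longleftrightarrow> jet_bound r M g x"
proof -
  have "\<partial> i f y = \<partial> i g y" if "y \<in> S" for i y
    using partial_deriv_cong_open[OF \<open>open S\<close> that eq] .
  moreover from this have "\<partial> i (\<partial> j f) x = \<partial> i (\<partial> j g) x" for i j
    using partial_deriv_cong_open[OF assms(1,2)] by blast
  ultimately show ?thesis using assms(2) eq unfolding jet_bound_def by simp
qed

lemma jet_bound_const: "\<bar>c\<bar> \<le> M \<Longrightarrow> jet_bound r M (\<lambda>x. c) x"
  unfolding jet_bound_def by auto

lemma jet_bound_affine:
  fixes f :: "real^'n \<Rightarrow> real"
  assumes f: "Ck_scalar 2 f" and a: "0 \<le> a"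
  shows "jet_bound s M (\<lambda>x. f (a *\<^sub>R x + v)) x \<longleftrightarrow> jet_bound (a * s) M f (a *\<^sub>R x + v)"
proof -
  note diff = Ck_scalar_2D(1,2)[OF f]
  have first: "\<partial> j (\<lambda>x. f (a *\<^sub>R x + v)) = (\<lambda>x. a * \<partial> j f (a *\<^sub>R x + v))" for j
    using partial_deriv_affine(2)[OF diff(1)] by fast
  have second: "\<partial> i (\<lambda>x. a * \<partial> j f (a *\<^sub>R x + v)) x = a * a * \<partial> i (\<partial> j f) (a *\<^sub>R x + v)" for i j
    by (simp add: partial_deriv_cmult partial_deriv_affine diff differentiable_affine)
  show ?thesis using a
    unfolding jet_bound_def first second by (simp add: abs_mult power2_eq_square ac_simps)
qed

lemma partial_deriv2_add:
  assumes "Ck_scalar 2 f" "Ck_scalar 2 g"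
  shows "\<partial> i (\<partial> j (\<lambda>x. f x + g x)) x = \<partial> i (\<partial> j f) x + \<partial> i (\<partial> j g) x"
proof -
  have "\<partial> j (\<lambda>x. f x + g x) = (\<lambda>x. \<partial> j f x + \<partial> j g x)"
    by (rule ext) (simp add: partial_deriv_add Ck_scalar_2D assms)
  then show ?thesis by (simp add: partial_deriv_add Ck_scalar_2D assms)
qed

lemma partial_deriv2_mult:
  assumes "Ck_scalar 2 f" "Ck_scalar 2 g"
  shows "\<partial> i (\<partial> j (\<lambda>x. f x * g x)) x =
    \<partial> i (\<partial> j f) x * g x + \<partial> j f x * \<partial> i g x + (\<partial> i f x * \<partial> j g x + f x * \<partial> i (\<partial> j g) x)"
proof -
  have "\<partial> j (\<lambda>x. f x * g x) = (\<lambda>x. \<partial> j f x * g x + f x * \<partial> j g x)"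
    by (rule ext) (simp add: partial_deriv_mult Ck_scalar_2D assms)
  then show ?thesis by (simp add: partial_deriv_add partial_deriv_mult Ck_scalar_2D assms)
qed

lemma jet_bound_add:
  assumes "Ck_scalar 2 f" "Ck_scalar 2 g" "jet_bound r M f x" "jet_bound r M' g x" "0 \<le> r"
  shows "jet_bound r (M + M') (\<lambda>x. f x + g x) x"
proof -
  have triangle: "\<bar>a + b\<bar> * s \<le> M + M'" if "\<bar>a\<bar> * s \<le> M" "\<bar>b\<bar> * s \<le> M'" "0 \<le> s" for a b s
    using that mult_right_mono[OF abs_triangle_ineq[of a b], of s] by (simp add: algebra_simps)
  show ?thesis
    using assms(3-) triangle[of _ 1] triangle[of _ r] triangle[of _ "r\<^sup>2"]
    unfolding jet_bound_def
    by (auto simp: partial_deriv_add partial_deriv2_add[OF assms(1,2)] Ck_scalar_2D[OF assms(1)]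
        Ck_scalar_2D[OF assms(2)])
qed

lemma jet_bound_mult:
  assumes C2: "Ck_scalar 2 f" "Ck_scalar 2 g"
    and f: "jet_bound r M f x" and g: "jet_bound r M' g x" and r: "0 \<le> r"
  shows "jet_bound r (4 * M * M') (\<lambda>x. f x * g x) x"
proof -
  have nonneg: "0 \<le> M" "0 \<le> M'" using f g jet_bound_nonneg by blast+
  have prod: "\<bar>a * b\<bar> * (s * t) \<le> M * M'" if "\<bar>a\<bar> * s \<le> M" "\<bar>b\<bar> * t \<le> M'" "0 \<le> s" "0 \<le> t" for a b s t
    using mult_mono[OF that(1,2)] that nonneg by (simp add: abs_mult ac_simps)
  have triangle: "\<bar>a + b\<bar> * s \<le> A + B" if "\<bar>a\<bar> * s \<le> A" "\<bar>b\<bar> * s \<le> B" "0 \<le> s" for a b s A B :: real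
    using that mult_right_mono[OF abs_triangle_ineq[of a b], of s] by (simp add: algebra_simps)
  have f0: "\<bar>f x\<bar> * 1 \<le> M" and g0: "\<bar>g x\<bar> * 1 \<le> M'" using jet_boundD(1) f g by simp_all
  note f1 = jet_boundD(2)[OF f] and f2 = jet_boundD(3)[OF f] and g1 = jet_boundD(2)[OF g]
    and g2 = jet_boundD(3)[OF g]
  have zeroth: "\<bar>f x * g x\<bar> \<le> M * M'"
    using prod[OF f0 g0] by simp
  have first: "\<bar>\<partial> i f x * g x + f x * \<partial> i g x\<bar> * r \<le> M * M' + M * M'" for i
    using prod[OF f1[of i] g0] prod[OF f0 g1[of i]] r by (intro triangle) simp_all
  have second: "\<bar>\<partial> i (\<partial> j f) x * g x + \<partial> j f x * \<partial> i g x
    + (\<partial> i f x * \<partial> j g x + f x * \<partial> i (\<partial> j g) x)\<bar> * (r * r)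
      \<le> M * M' + M * M' + (M * M' + M * M')" for i j
    using prod[OF f2[of i j] g0] prod[OF f0 g2[of i j]] prod[OF f1[of i] g1[of j]]
      prod[OF f1[of j] g1[of i]] r
    by (intro triangle) simp_all
  have "M * M' \<ge> 0" using nonneg by simp
  show ?thesis
  proof (rule jet_boundI)
    show "\<bar>f x * g x\<bar> \<le> 4 * M * M'"
      using zeroth \<open>M * M' \<ge> 0\<close> by simp
    show "\<bar>\<partial> i (\<lambda>x. f x * g x) x\<bar> * r \<le> 4 * M * M'" for i
      using first[of i] \<open>M * M' \<ge> 0\<close> by (simp add: partial_deriv_mult Ck_scalar_2D(1) C2)
    show "\<bar>\<partial> i (\<partial> j (\<lambda>x. f x * g x)) x\<bar> * (r * r) \<le> 4 * M * M'" for i j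
      using second[of i j] by (simp add: partial_deriv2_mult C2)
  qed
qed

lemma jet_bound_exists:
  fixes f :: "real^'n \<Rightarrow> real"
  assumes "0 \<le> r"
  shows "\<exists>M. jet_bound r M f x"
proof
  let ?S = "insert \<bar>f x\<bar> (range (\<lambda>i. \<bar>\<partial> i f x\<bar> * r) \<union> range (\<lambda>(i, j). \<bar>\<partial> i (\<partial> j f) x\<bar> * (r * r)))"
  show "jet_bound r (Max ?S) f x" by (intro jet_boundI Max_ge) auto
qed

lemma jet_bound_mult_0:
  fixes f :: "real^'n \<Rightarrow> real"
  assumes "Ck_scalar 2 f" "Ck_scalar 2 g" "jet_bound r 0 f x" "0 \<le> r"
  shows "jet_bound r 0 (\<lambda>x. f x * g x) x"
  using jet_bound_exists[OF assms(4), of g x] jet_bound_mult[OF assms(1,2,3) _ assms(4)] by auto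

lemma jet_bound_minus:
  assumes "Ck_scalar 2 f" "jet_bound r M f x"
  shows "jet_bound r M (\<lambda>x. - f x) x"
proof -
  have "\<partial> j (\<lambda>x. - f x) = (\<lambda>x. - \<partial> j f x)" for j
    by (rule ext) (simp add: partial_deriv_minus Ck_scalar_2D[OF assms(1)])
  then show ?thesis
    using assms(2) unfolding jet_bound_def
    by (simp add: partial_deriv_minus Ck_scalar_2D[OF assms(1)])
qed

lemma jet_bound_diff:
  assumes "Ck_scalar 2 f" "Ck_scalar 2 g" "jet_bound r M f x" "jet_bound r M' g x" "0 \<le> r"
  shows "jet_bound r (M + M') (\<lambda>x. f x - g x) x"
  using jet_bound_add[OF assms(1) Ck_scalar_minus[OF assms(2)] assms(3)
    jet_bound_minus[OF assms(2,4)] assms(5)]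
  by simp

lemma jet_bound_sum:
  assumes "finite I" "\<And>p. p \<in> I \<Longrightarrow> Ck_scalar 2 (f p)" "\<And>p. p \<in> I \<Longrightarrow> jet_bound r M (f p) x" "0 \<le> r"
  shows "jet_bound r (real (card I) * M) (\<lambda>x. \<Sum>p\<in>I. f p x) x"
  using assms(1-3)
proof (induction I)
  case empty
  then show ?case by (simp add: jet_bound_const)
next
  case (insert p I)
  then have "jet_bound r (M + real (card I) * M) (\<lambda>x. f p x + (\<Sum>p\<in>I. f p x)) x"
    using \<open>0 \<le> r\<close> by (intro jet_bound_add Ck_scalar_sum) auto
  then show ?case using insert.hyps by (simp add: algebra_simps)
qed

lemma ex_jet_bound_compact_support:
  fixes f :: "real^'n \<Rightarrow> real"
  assumes f: "Ck_scalar 2 f" and supp: "bounded {x. f x \<noteq> 0}"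
  shows "\<exists>B. \<forall>x. jet_bound 1 B f x"
proof -
  have "bounded (range f)" "bounded (range (\<partial> i f))" "bounded (range (\<partial> i (\<partial> j f)))" for i j
    using Ck_scalar_continuous[OF f] Ck_scalar_2D(3,4)[OF f] supp
    by (auto intro!: bounded_range_compact_support bounded_support_partial_deriv)
  then have "bounded (range f \<union> (\<Union>i. range (\<partial> i f)) \<union> (\<Union>i. \<Union>j. range (\<partial> i (\<partial> j f))))"
    by (intro bounded_Un[THEN iffD2] conjI bounded_UN) auto
  then obtain B where "\<And>x. \<bar>f x\<bar> \<le> B" "\<And>i x. \<bar>\<partial> i f x\<bar> \<le> B" "\<And>i j x. \<bar>\<partial> i (\<partial> j f) x\<bar> \<le> B"
    unfolding bounded_iff by (auto simp: ball_Un)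
  then have "jet_bound 1 B f x" for x
    by (intro jet_boundI) simp_all
  then show ?thesis by blast
qed

section \<open>Taylor polynomials\<close>

definition lipschitz_hessian :: "real \<Rightarrow> (real^'n \<Rightarrow> real) \<Rightarrow> bool" where
  "lipschitz_hessian L f \<longleftrightarrow> (\<forall>i j. L-lipschitz_on UNIV (\<partial> i (\<partial> j f)))"

lemma lipschitz_hessianD:
  "lipschitz_hessian L f \<Longrightarrow> \<bar>\<partial> i (\<partial> j f) x - \<partial> i (\<partial> j f) y\<bar> \<le> L * dist x y"
  unfolding lipschitz_hessian_def lipschitz_on_def by (simp add: dist_real_def)

lemma lipschitz_hessian_nonneg: "lipschitz_hessian L f \<Longrightarrow> 0 \<le> L"
  unfolding lipschitz_hessian_def using lipschitz_on_nonneg by blast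

lemma ex_lipschitz_hessian_compact_support:
  fixes f :: "real^'n \<Rightarrow> real"
  assumes f: "Ck_scalar 3 f" and supp: "bounded {x. f x \<noteq> 0}"
  shows "\<exists>L. lipschitz_hessian L f"
proof -
  have "\<exists>L. L-lipschitz_on UNIV (\<partial> i (\<partial> j f))" for i j
    using f by (intro ex_lipschitz_compact_support bounded_support_partial_deriv supp)
      (simp add: numeral_3_eq_3 Ck_scalar_Suc)
  then obtain L where L: "\<And>i j. (L i j)-lipschitz_on UNIV (\<partial> i (\<partial> j f))" by metis
  have "L i j \<le> Max (range (\<lambda>(i, j). L i j))" for i j
    by (rule Max_ge) auto
  then show ?thesis
    unfolding lipschitz_hessian_def using lipschitz_on_mono[OF L] by blast
qed

lemma jet_bound_near_jet_zero:
  fixes f :: "real^'n \<Rightarrow> real"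
  assumes f: "Ck_scalar 2 f" and lip: "lipschitz_hessian L f"
    and zero: "f y = 0" "\<And>i. \<partial> i f y = 0" "\<And>i j. \<partial> i (\<partial> j f) y = 0"
    and x: "dist x y \<le> d"
  shows "jet_bound d ((real CARD('n))\<^sup>2 * L * d ^ 3) f x"
proof -
  let ?n = "real CARD('n)"
  have d: "0 \<le> d" using x zero_le_dist order_trans by blast
  have L: "0 \<le> L" using lip by (rule lipschitz_hessian_nonneg)
  have "1 \<le> ?n" by (simp add: Suc_le_eq)
  then have n: "1 \<le> ?n\<^sup>2" "?n \<le> ?n\<^sup>2" by (simp_all add: one_le_power self_le_power)
  have second: "\<bar>\<partial> i (\<partial> j f) z\<bar> \<le> L * d" if "z \<in> cball y d" for i j z
    using lipschitz_hessianD[OF lip, of i j z y] that mult_left_mono[of "dist z y" d L] L zero(3)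
    by (simp add: dist_commute)
  have first: "\<bar>\<partial> i f z\<bar> \<le> ?n * L * d\<^sup>2" if z: "z \<in> cball y d" for i z
  proof -
    have "(?n * (L * d))-lipschitz_on (cball y d) (\<partial> i f)"
      using second Ck_scalar_2D[OF f] L d by (intro lipschitz_on_partial_deriv) auto
    from lipschitz_onD[OF this z, of y] have "\<bar>\<partial> i f z\<bar> \<le> ?n * (L * d) * dist z y"
      using d zero by (simp add: dist_real_def)
    also have "\<dots> \<le> ?n * (L * d) * d" using z L d by (simp add: mult_left_mono dist_commute)
    finally show ?thesis by (simp add: power2_eq_square ac_simps)
  qed
  have zeroth: "\<bar>f x\<bar> \<le> ?n\<^sup>2 * L * d ^ 3"
  proof -
    have "(?n * (?n * L * d\<^sup>2))-lipschitz_on (cball y d) f"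
      using first Ck_scalar_2D[OF f] L by (intro lipschitz_on_partial_deriv) auto
    from lipschitz_onD[OF this, of x y] have "\<bar>f x\<bar> \<le> ?n * (?n * L * d\<^sup>2) * dist x y"
      using x d zero by (simp add: dist_real_def dist_commute)
    also have "\<dots> \<le> ?n * (?n * L * d\<^sup>2) * d" using x L by (simp add: mult_left_mono)
    finally show ?thesis by (simp add: power2_eq_square power3_eq_cube ac_simps)
  qed
  have "x \<in> cball y d" using x by (simp add: dist_commute)
  note at_x = this[THEN first] this[THEN second]
  have le: "L * d ^ 3 \<le> ?n\<^sup>2 * (L * d ^ 3)" "?n * (L * d ^ 3) \<le> ?n\<^sup>2 * (L * d ^ 3)"
    using n L d mult_right_mono[of 1 "?n\<^sup>2" "L * d ^ 3"] by (auto intro: mult_right_mono)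
  show ?thesis
  proof (rule jet_boundI)
    show "\<bar>\<partial> i f x\<bar> * d \<le> ?n\<^sup>2 * L * d ^ 3" for i
      using mult_right_mono[OF at_x(1)[of i] d] le
      by (simp add: power2_eq_square power3_eq_cube ac_simps)
    show "\<bar>\<partial> i (\<partial> j f) x\<bar> * (d * d) \<le> ?n\<^sup>2 * L * d ^ 3" for i j
      using mult_right_mono[OF at_x(2)[of i j], of "d * d"] le
      by (simp add: power2_eq_square power3_eq_cube ac_simps)
  qed (rule zeroth)
qed

definition taylor1 :: "(real^'n \<Rightarrow> real) \<Rightarrow> real^'n \<Rightarrow> real^'n \<Rightarrow> real" where
  "taylor1 f y x = f y + (\<Sum>i\<in>UNIV. \<partial> i f y * (x $ i - y $ i))"

definition taylor2 :: "(real^'n \<Rightarrow> real) \<Rightarrow> real^'n \<Rightarrow> real^'n \<Rightarrow> real" where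
  "taylor2 f y x = taylor1 f y x +
    (\<Sum>i\<in>UNIV. \<Sum>j\<in>UNIV. \<partial> i (\<partial> j f) y * ((x $ i - y $ i) * (x $ j - y $ j))) / 2"

lemma smooth_taylor1: "smooth (taylor1 f y)"
  unfolding taylor1_def
  by (intro allI Ck_scalar_add Ck_scalar_sum Ck_scalar_mult Ck_scalar_diff Ck_scalar_const
      Ck_scalar_nth)

lemma smooth_taylor2: "smooth (taylor2 f y)"
  unfolding taylor2_def divide_inverse
  by (intro allI Ck_scalar_add Ck_scalar_sum Ck_scalar_mult Ck_scalar_diff Ck_scalar_const
      Ck_scalar_nth
      smooth_taylor1[rule_format])

lemma partial_deriv_taylor1: "\<partial> k (taylor1 f y) = (\<lambda>x. \<partial> k f y)"
proof
  fix x
  have "(taylor1 f y has_derivative (\<lambda>h. \<Sum>i\<in>UNIV. \<partial> i f y * h $ i)) (at x)"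
    unfolding taylor1_def
    by (auto intro!: derivative_eq_intros
        bounded_linear_imp_has_derivative[OF bounded_linear_vec_nth])
  from partial_deriv_eqI[OF this] show "\<partial> k (taylor1 f y) x = \<partial> k f y"
    by (simp add: axis_def if_distrib[of "(*) _"] cong: if_cong)
qed

lemma partial_deriv_taylor2:
  fixes f :: "real^'n \<Rightarrow> real"
  assumes f: "Ck_scalar 2 f"
  shows "\<partial> k (taylor2 f y) = taylor1 (\<partial> k f) y"
proof
  fix x
  let ?z = "\<lambda>i. x $ i - y $ i"
  have delta: "(\<Sum>i\<in>UNIV. \<Sum>j\<in>UNIV. if i = k then c j else 0) = (\<Sum>j\<in>UNIV. c j)" for c :: "'n \<Rightarrow> real"
    by (subst sum.swap) simp
  have "(taylor2 f y has_derivative (\<lambda>h. (\<Sum>i\<in>UNIV. \<partial> i f y * h $ i) +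
      (\<Sum>i\<in>UNIV. \<Sum>j\<in>UNIV. \<partial> i (\<partial> j f) y * (?z i * h $ j + h $ i * ?z j)) / 2)) (at x)"
    unfolding taylor2_def taylor1_def
    by (auto intro!: derivative_eq_intros
        bounded_linear_imp_has_derivative[OF bounded_linear_vec_nth])
  from partial_deriv_eqI[OF this, of k]
  have "\<partial> k (taylor2 f y) x = \<partial> k f y +
      ((\<Sum>i\<in>UNIV. \<partial> i (\<partial> k f) y * ?z i) + (\<Sum>j\<in>UNIV. \<partial> k (\<partial> j f) y * ?z j)) / 2"
    by (simp add: axis_def distrib_left sum.distrib if_distrib[of "(*) _"]
        if_distrib[of "\<lambda>a. a * _"] delta cong: if_cong)
  also have "\<dots> = taylor1 (\<partial> k f) y x"
    by (simp add: taylor1_def partial_deriv_commute[OF f, of k])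
  finally show "\<partial> k (taylor2 f y) x = taylor1 (\<partial> k f) y x" .
qed

lemma jet_bound_taylor2_remainder:
  fixes f :: "real^'n \<Rightarrow> real"
  assumes f: "Ck_scalar 2 f" and lip: "lipschitz_hessian L f" and x: "dist x y \<le> d"
  shows "jet_bound d ((real CARD('n))\<^sup>2 * L * d ^ 3) (\<lambda>x. f x - taylor2 f y x) x"
proof -
  note diff = Ck_scalar_2D(1,2)[OF f] Ck_scalar_2D(1,2)[OF smooth_taylor2[rule_format]]
  have first: "\<partial> i (\<lambda>x. f x - taylor2 f y x) = (\<lambda>x. \<partial> i f x - taylor1 (\<partial> i f) y x)" for i
    by (rule ext) (simp add: partial_deriv_diff diff partial_deriv_taylor2[OF f])
  have second: "\<partial> i (\<partial> j (\<lambda>x. f x - taylor2 f y x)) = (\<lambda>x. \<partial> i (\<partial> j f) x - \<partial> i (\<partial> j f) y)" for i j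
    unfolding first
    by (intro ext) (simp add: partial_deriv_diff diff
        Ck_scalar_2D(1)[OF smooth_taylor1[rule_format]] partial_deriv_taylor1)
  show ?thesis
  proof (rule jet_bound_near_jet_zero[OF _ _ _ _ _ x])
    show "Ck_scalar 2 (\<lambda>x. f x - taylor2 f y x)" using f smooth_taylor2 by (intro Ck_scalar_diff) auto
    show "lipschitz_hessian L (\<lambda>x. f x - taylor2 f y x)"
      using lip unfolding lipschitz_hessian_def second by (auto simp: lipschitz_on_def dist_norm)
    show "\<partial> i (\<lambda>x. f x - taylor2 f y x) y = 0" for i by (simp add: first taylor1_def)
    show "\<partial> i (\<partial> j (\<lambda>x. f x - taylor2 f y x)) y = 0" for i j by (simp add: second)
  qed (simp add: taylor1_def taylor2_def)
qed

lemma jet_bound_near_critical_point: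
  fixes f :: "real^'n \<Rightarrow> real"
  assumes f: "Ck_scalar 2 f" and lip: "lipschitz_hessian L f"
    and zero: "\<And>i. \<partial> i f y = 0" "\<And>i j. \<partial> i (\<partial> j f) y = 0" and x: "dist x y \<le> d"
  shows "jet_bound d ((real CARD('n))\<^sup>2 * L * d ^ 3) (\<lambda>x. f x - f y) x"
proof -
  have "taylor2 f y = (\<lambda>x. f y)" by (simp add: taylor2_def taylor1_def zero fun_eq_iff)
  then show ?thesis using jet_bound_taylor2_remainder[OF f lip x] by simp
qed

section \<open>A smooth bump function\<close>

text \<open>A class of functions, flat at the origin, that is closed under differentiation.\<close>

definition flat :: "real poly \<Rightarrow> real \<Rightarrow> real" where
  "flat p t = (if t > 0 then poly p (1 / t) * exp (- (1 / t)) else 0)"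

lemma tendsto_poly_exp_minus: "((\<lambda>t::real. poly p t * exp (- t)) \<longlongrightarrow> 0) at_top"
proof -
  have "((\<lambda>t. \<Sum>i\<le>degree p. coeff p i * (t ^ i / exp t)) \<longlongrightarrow> (\<Sum>i\<le>degree p. coeff p i * 0)) at_top"
    by (intro tendsto_intros tendsto_power_div_exp_0)
  then show ?thesis
    by (simp add: poly_altdef exp_minus divide_inverse sum_distrib_right mult.assoc)
qed

lemma flat_div_tendsto_0: "((\<lambda>t. flat p t / t) \<longlongrightarrow> 0) (at 0)"
proof -
  have "((\<lambda>t. poly (pCons 0 p) (inverse t) * exp (- inverse t)) \<longlongrightarrow> 0) (at_right 0)"
    by (rule filterlim_compose[OF tendsto_poly_exp_minus filterlim_inverse_at_top_right])
  then have "((\<lambda>t. flat p t / t) \<longlongrightarrow> 0) (at_right 0)"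
    by (rule Lim_transform_eventually)
       (auto simp: flat_def eventually_at_right_less divide_inverse
         intro!: eventually_at_rightI[of 0 1])
  moreover have "((\<lambda>t. flat p t / t) \<longlongrightarrow> 0) (at_left 0)"
    by (rule Lim_transform_eventually[of "\<lambda>_. 0"])
       (auto simp: flat_def intro!: eventually_at_leftI[of "-1"])
  ultimately show ?thesis by (simp add: filterlim_split_at)
qed

lemma DERIV_flat:
  "(flat p has_real_derivative flat ([:0, 0, 1:] * (p - pderiv p)) t) (at t)"
proof -
  consider (neg) "t < 0" | (zero) "t = 0" | (pos) "t > 0" by linarith
  then show ?thesis
  proof cases
    case neg
    have "(flat p has_real_derivative 0) (at t)"
      by (rule has_field_derivative_transform_within_open[of "\<lambda>_. 0" 0 t "{..<0}"])
         (use neg in \<open>auto simp: flat_def\<close>)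
    then show ?thesis using neg by (simp add: flat_def)
  next
    case zero
    then show ?thesis using flat_div_tendsto_0 by (simp add: has_field_derivative_iff flat_def)
  next
    case pos
    have "((\<lambda>t. poly p (1 / t) * exp (- (1 / t))) has_real_derivative
      flat ([:0, 0, 1:] * (p - pderiv p)) t) (at t)"
      using pos by (auto intro!: derivative_eq_intros DERIV_chain'[OF _ poly_DERIV] simp: flat_def)
        (simp add: field_simps power2_eq_square)
    then show ?thesis
      using pos by (auto elim!: has_field_derivative_transform_within_open[where S="{0<..}"]
        simp: flat_def)
  qed
qed

lemma Ck_scalar_flat: "Ck_scalar k (\<lambda>x::real^'n. flat p (x $ i))"
proof (induction k arbitrary: p)
  case 0
  have "continuous_on UNIV (flat p)"
    by (intro continuous_at_imp_continuous_on ballI DERIV_isCont[OF DERIV_flat])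
  then show ?case
    using continuous_on_compose2[of UNIV "flat p" UNIV "\<lambda>x::real^'n. x $ i"]
    by (simp add: continuous_on_component continuous_on_id)
next
  case (Suc k)
  have "\<partial> j (\<lambda>x::real^'n. flat p (x $ i))
      = (\<lambda>x. if i = j then flat ([:0, 0, 1:] * (p - pderiv p)) (x $ i) else 0)" for j
    using partial_deriv_coordinate(2)[OF DERIV_flat] by fast
  then have "Ck_scalar k (\<partial> j (\<lambda>x::real^'n. flat p (x $ i)))" for j
    using Suc Ck_scalar_const[of k 0] by (cases "i = j") simp_all
  then show ?case
    by (simp add: Ck_scalar_Suc differentiable_coordinate[OF DERIV_flat])
qed

definition smooth_step :: "real \<Rightarrow> real" where
  "smooth_step t = flat 1 t * inverse (flat 1 t + flat 1 (1 - t))"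

lemma smooth_step_eq_0: "t \<le> 0 \<Longrightarrow> smooth_step t = 0"
  by (simp add: smooth_step_def flat_def)

lemma smooth_step_eq_1: "t \<ge> 1 \<Longrightarrow> smooth_step t = 1"
  by (simp add: smooth_step_def flat_def)

lemma Ck_scalar_smooth_step: "Ck_scalar k (\<lambda>x::real^'n. smooth_step (x $ i))"
proof -
  have "Ck_scalar k (\<lambda>x::real^'n. flat 1 (1 - x $ i))"
    using Ck_scalar_affine[OF Ck_scalar_flat[of k 1 i], of "-1" "vec 1"] by simp
  moreover have "flat 1 t + flat 1 (1 - t) > 0" for t
    by (cases "t > 0"; cases "1 - t > 0") (auto simp: flat_def add_pos_pos)
  then have "flat 1 t + flat 1 (1 - t) \<noteq> 0" for t
    by (simp add: less_imp_neq[symmetric])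
  ultimately show ?thesis unfolding smooth_step_def
    by (intro Ck_scalar_mult Ck_scalar_inverse Ck_scalar_add Ck_scalar_flat)
qed

definition bump1 :: "real \<Rightarrow> real" where
  "bump1 t = smooth_step (t + 1) - smooth_step t"

lemma bump1_eq_0: "1 \<le> \<bar>t\<bar> \<Longrightarrow> bump1 t = 0"
  by (auto simp: bump1_def abs_if smooth_step_eq_0 smooth_step_eq_1 split: if_splits)

lemma sum_bump1_translates: "(\<Sum>m\<in>{\<lfloor>t\<rfloor> - 1..\<lfloor>t\<rfloor> + 1}. bump1 (t - of_int m)) = 1"
proof -
  have "{\<lfloor>t\<rfloor> - 1..\<lfloor>t\<rfloor> + 1} = {\<lfloor>t\<rfloor> - 1, \<lfloor>t\<rfloor>, \<lfloor>t\<rfloor> + 1}" by auto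
  then have "(\<Sum>m\<in>{\<lfloor>t\<rfloor> - 1..\<lfloor>t\<rfloor> + 1}. bump1 (t - of_int m))
      = smooth_step (t - of_int \<lfloor>t\<rfloor> + 2) - smooth_step (t - of_int \<lfloor>t\<rfloor> - 1)"
    by (simp add: bump1_def algebra_simps)
  moreover have "0 \<le> t - of_int \<lfloor>t\<rfloor>" "t - of_int \<lfloor>t\<rfloor> \<le> 1" by linarith+
  ultimately show ?thesis by (simp add: smooth_step_eq_0 smooth_step_eq_1)
qed

definition bump :: "real^'n \<Rightarrow> real" where
  "bump x = (\<Prod>i\<in>UNIV. bump1 (x $ i))"

lemma smooth_bump: "smooth (bump :: real^'n \<Rightarrow> real)"
proof
  fix k
  have "Ck_scalar k (\<lambda>x::real^'n. smooth_step (x $ i + 1))" for i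
    using Ck_scalar_affine[OF Ck_scalar_smooth_step[of k i], of "1" "vec 1"] by simp
  then show "Ck_scalar k (bump :: real^'n \<Rightarrow> real)" unfolding bump_def bump1_def
    by (intro Ck_scalar_prod Ck_scalar_diff Ck_scalar_smooth_step)
qed

lemma bump_nonzeroD: "bump x \<noteq> 0 \<Longrightarrow> \<bar>x $ i\<bar> < 1"
  using bump1_eq_0[of "x $ i"] by (force simp: bump_def)

lemma ex_bump_jet_bound: "\<exists>B. \<forall>x::real^'n. jet_bound 1 B bump x"
proof (rule ex_jet_bound_compact_support)
  have "x \<in> cbox (vec (-1)) (vec 1)" if "bump x \<noteq> 0" for x :: "real^'n"
    using bump_nonzeroD[OF that] by (simp add: mem_box_cart abs_less_iff less_imp_le minus_less_iff)
  then show "bounded {x::real^'n. bump x \<noteq> 0}"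
    by (intro bounded_subset[OF bounded_cbox[of "vec (-1)" "vec 1"]] subsetI) simp
qed (use smooth_bump in blast)

section \<open>Gluing over a grid\<close>

definition node :: "real \<Rightarrow> ('n \<Rightarrow> int) \<Rightarrow> real^'n" where
  "node r p = (\<chi> i. r * of_int (p i))"

definition cell :: "real \<Rightarrow> ('n \<Rightarrow> int) \<Rightarrow> real^'n \<Rightarrow> real" where
  "cell r p x = bump (inverse r *\<^sub>R x + - node 1 p)"

definition adjacent_nodes :: "real \<Rightarrow> real^'n \<Rightarrow> ('n \<Rightarrow> int) set" where
  "adjacent_nodes r x = (\<Pi>\<^sub>E i\<in>UNIV. {\<lfloor>x $ i / r\<rfloor> - 1..\<lfloor>x $ i / r\<rfloor> + 1})"

lemma finite_adjacent_nodes: "finite (adjacent_nodes r (x :: real^'n))"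
  by (simp add: adjacent_nodes_def finite_PiE)

lemma card_adjacent_nodes: "card (adjacent_nodes r (x :: real^'n)) = 3 ^ CARD('n)"
  by (simp add: adjacent_nodes_def card_PiE)

lemma dist_adjacent_node:
  fixes x :: "real^'n"
  assumes r: "0 < r" and p: "p \<in> adjacent_nodes r x"
  shows "dist x (node r p) \<le> 2 * real CARD('n) * r"
proof -
  have "\<bar>(x - node r p) $ i\<bar> \<le> 2 * r" for i
  proof -
    have "\<lfloor>x $ i / r\<rfloor> - 1 \<le> p i" "p i \<le> \<lfloor>x $ i / r\<rfloor> + 1"
      using p by (auto simp: adjacent_nodes_def PiE_iff)
    then have "of_int (p i) - 2 \<le> x $ i / r" "x $ i / r \<le> of_int (p i) + 2" by linarith+
    then show ?thesis using r by (simp add: node_def field_simps abs_le_iff)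
  qed
  then have "(\<Sum>i\<in>UNIV. \<bar>(x - node r p) $ i\<bar>) \<le> CARD('n) * (2 * r)"
    by (rule sum_bounded_above)
  then show ?thesis
    using norm_le_l1_cart[of "x - node r p"] by (simp add: dist_norm)
qed

lemma smooth_cell: "smooth (cell r p)"
  unfolding cell_def using smooth_bump by (intro allI Ck_scalar_affine) auto

lemma jet_bound_cell_iff:
  "0 < r \<Longrightarrow> jet_bound r M (cell r p) x \<longleftrightarrow> jet_bound 1 M bump (inverse r *\<^sub>R x + - node 1 p)"
  unfolding cell_def by (subst jet_bound_affine) (use smooth_bump in auto)

definition adjacency_neighbourhood :: "real \<Rightarrow> real^'n \<Rightarrow> (real^'n) set" where
  "adjacency_neighbourhood r x =
    box (\<chi> i. r * (of_int \<lfloor>x $ i / r\<rfloor> - 1)) (\<chi> i. r * (of_int \<lfloor>x $ i / r\<rfloor> + 1))"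

lemma open_adjacency_neighbourhood: "open (adjacency_neighbourhood r x)"
  by (simp add: adjacency_neighbourhood_def open_box)

lemma mem_adjacency_neighbourhood:
  fixes x :: "real^'n"
  assumes r: "0 < r"
  shows "x \<in> adjacency_neighbourhood r x"
proof -
  have "r * (of_int \<lfloor>x $ i / r\<rfloor> - 1) < x $ i" "x $ i < r * (of_int \<lfloor>x $ i / r\<rfloor> + 1)" for i
  proof -
    have "of_int \<lfloor>x $ i / r\<rfloor> - 1 < x $ i / r" "x $ i / r < of_int \<lfloor>x $ i / r\<rfloor> + 1" by linarith+
    then show "r * (of_int \<lfloor>x $ i / r\<rfloor> - 1) < x $ i" "x $ i < r * (of_int \<lfloor>x $ i / r\<rfloor> + 1)"
      using r by (simp_all only: pos_less_divide_eq pos_divide_less_eq mult.commute)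
  qed
  then show ?thesis by (simp add: adjacency_neighbourhood_def mem_box_cart)
qed

lemma cell_nonzero_subset_adjacent_nodes:
  assumes r: "0 < r" and y: "y \<in> adjacency_neighbourhood r x"
  shows "{p. cell r p y \<noteq> 0} \<subseteq> adjacent_nodes r x"
proof
  fix p assume p: "p \<in> {p. cell r p y \<noteq> 0}"
  have "p i \<in> {\<lfloor>x $ i / r\<rfloor> - 1..\<lfloor>x $ i / r\<rfloor> + 1}" for i
  proof -
    have "\<bar>y $ i / r - of_int (p i)\<bar> < 1"
      using p bump_nonzeroD[of "inverse r *\<^sub>R y + - node 1 p" i]
      by (simp add: cell_def node_def divide_inverse mult.commute)
    moreover have "of_int \<lfloor>x $ i / r\<rfloor> - 1 < y $ i / r" "y $ i / r < of_int \<lfloor>x $ i / r\<rfloor> + 1"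
      using y r by (auto simp: adjacency_neighbourhood_def mem_box_cart pos_less_divide_eq
        pos_divide_less_eq mult.commute)
    ultimately show ?thesis by auto
  qed
  then show "p \<in> adjacent_nodes r x" by (auto simp: adjacent_nodes_def PiE_iff)
qed

definition glue :: "real \<Rightarrow> (('n \<Rightarrow> int) \<Rightarrow> real^'n \<Rightarrow> real) \<Rightarrow> real^'n \<Rightarrow> real" where
  "glue r F x = (\<Sum>p | cell r p x \<noteq> 0. F p x * cell r p x)"

lemma glue_eq_sum_adjacent:
  assumes "0 < r" "y \<in> adjacency_neighbourhood r x"
  shows "glue r F y = (\<Sum>p\<in>adjacent_nodes r x. F p y * cell r p y)"
  unfolding glue_def
  by (rule sum.mono_neutral_left)
      (use finite_adjacent_nodes cell_nonzero_subset_adjacent_nodes[OF assms] in auto)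

lemma Ck_scalar_glue:
  assumes r: "0 < r" and F: "\<And>p. Ck_scalar k (F p)"
  shows "Ck_scalar k (glue r F)"
proof (rule Ck_scalar_local)
  fix x
  let ?S = "\<lambda>y. \<Sum>p\<in>adjacent_nodes r x. F p y * cell r p y"
  have "Ck_scalar k ?S"
    using smooth_cell by (intro Ck_scalar_sum Ck_scalar_mult F) blast
  then show "\<exists>S g. open S \<and> x \<in> S \<and> Ck_scalar k g \<and> (\<forall>y\<in>S. glue r F y = g y)"
    using open_adjacency_neighbourhood mem_adjacency_neighbourhood[OF r]
      glue_eq_sum_adjacent[OF r, of _ x F] by blast
qed

lemma jet_bound_glue:
  fixes F :: "('n \<Rightarrow> int) \<Rightarrow> real^'n \<Rightarrow> real"
  assumes bump: "\<And>z::real^'n. jet_bound 1 B bump z" and r: "0 < r"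
    and C2: "\<And>p. Ck_scalar 2 (F p)"
    and F: "\<And>p. dist x (node r p) \<le> 2 * real CARD('n) * r \<Longrightarrow> jet_bound r M (F p) x"
  shows "jet_bound r (4 * 3 ^ CARD('n) * B * M) (glue r F) x"
proof -
  have "jet_bound r (4 * M * B) (\<lambda>x. F p x * cell r p x) x" if "p \<in> adjacent_nodes r x" for p
    using smooth_cell r dist_adjacent_node[OF r that]
    by (intro jet_bound_mult C2 F jet_bound_cell_iff[OF r, THEN iffD2] bump) auto
  then have "jet_bound r (card (adjacent_nodes r x) * (4 * M * B))
    (\<lambda>x'. \<Sum>p\<in>adjacent_nodes r x. F p x' * cell r p x') x"
    using r smooth_cell by (intro jet_bound_sum finite_adjacent_nodes Ck_scalar_mult C2) auto
  then have "jet_bound r (card (adjacent_nodes r x) * (4 * M * B)) (glue r F) x"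
    by (subst jet_bound_cong_open[OF open_adjacency_neighbourhood mem_adjacency_neighbourhood[OF r]])
       (auto intro: glue_eq_sum_adjacent[OF r])
  then show ?thesis by (simp add: card_adjacent_nodes ac_simps)
qed

lemma glue_const:
  fixes f :: "real^'n \<Rightarrow> real"
  assumes r: "0 < r"
  shows "glue r (\<lambda>p. f) x = f x"
proof -
  let ?I = "\<lambda>i. {\<lfloor>x $ i / r\<rfloor> - 1..\<lfloor>x $ i / r\<rfloor> + 1}"
  have "(\<Sum>p\<in>adjacent_nodes r x. cell r p x)
    = (\<Sum>p\<in>PiE UNIV ?I. \<Prod>i\<in>UNIV. bump1 (x $ i / r - of_int (p i)))"
    by (simp add: adjacent_nodes_def cell_def bump_def node_def divide_inverse mult.commute)
  also have "\<dots> = (\<Prod>i\<in>UNIV. \<Sum>m\<in>?I i. bump1 (x $ i / r - of_int m))"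
    by (rule prod_sum_PiE[symmetric]) auto
  also have "\<dots> = 1" by (simp only: sum_bump1_translates prod.neutral_const)
  finally show ?thesis
    by (simp add: glue_eq_sum_adjacent[OF r mem_adjacency_neighbourhood[OF r]] flip: sum_distrib_left)
qed

lemma glue_diff: "glue r (\<lambda>p x. F p x - G p x) x = glue r F x - glue r G x"
  by (simp add: glue_def left_diff_distrib sum_subtractf)

lemma glue_nonzeroD:
  fixes x :: "real^'n"
  assumes r: "0 < r" and "glue r F x \<noteq> 0"
  shows "\<exists>p. F p x \<noteq> 0 \<and> dist x (node r p) \<le> 2 * real CARD('n) * r"
proof -
  obtain p where "p \<in> adjacent_nodes r x" "F p x * cell r p x \<noteq> 0"
    using assms(2) sum.not_neutral_contains_not_neutral
    unfolding glue_eq_sum_adjacent[OF r mem_adjacency_neighbourhood[OF r]] by blast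
  then show ?thesis using dist_adjacent_node[OF r] by auto
qed

section \<open>Approximation at one scale\<close>

lemma bounded_neighbourhood:
  assumes "bounded S"
  shows "bounded {x. \<exists>y\<in>S. dist x y \<le> e}"
proof -
  obtain z b where "\<And>y. y \<in> S \<Longrightarrow> dist z y \<le> b"
    using assms unfolding bounded_def by blast
  then have "dist z x \<le> b + e" if "y \<in> S" "dist x y \<le> e" for x y
    using that dist_triangle[of z x y] by (smt (verit) dist_commute)
  then show ?thesis unfolding bounded_def by blast
qed

lemma taylor2_eq_0_outside_support:
  assumes "y \<notin> closure {x. f x \<noteq> 0}"
  shows "taylor2 f y x = 0"
proof -
  have "{x. \<partial> i (\<partial> j f) x \<noteq> 0} \<subseteq> closure {x. f x \<noteq> 0}" for i j
    using partial_deriv_support_subset[of i "\<partial> j f"]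
      closure_minimal[OF partial_deriv_support_subset closed_closure, of j f] by (rule subset_trans)
  then have "f y = 0" "\<partial> i f y = 0" "\<partial> i (\<partial> j f) y = 0" for i j
    using assms closure_subset[of "{x. f x \<noteq> 0}"] partial_deriv_support_subset[of i f] by blast+
  then show ?thesis by (simp add: taylor2_def taylor1_def)
qed

definition glued_taylor :: "real \<Rightarrow> (real^'n \<Rightarrow> real) \<Rightarrow> real^'n \<Rightarrow> real" where
  "glued_taylor r f = glue r (\<lambda>p. taylor2 f (node r p))"

lemma smooth_glued_taylor: "0 < r \<Longrightarrow> smooth (glued_taylor r f)"
  unfolding glued_taylor_def by (intro allI Ck_scalar_glue smooth_taylor2[rule_format])

lemma bounded_support_glued_taylor:
  fixes f :: "real^'n \<Rightarrow> real"
  assumes r: "0 < r" and supp: "bounded {x. f x \<noteq> 0}"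
  shows "bounded {x. glued_taylor r f x \<noteq> 0}"
proof (rule bounded_subset[OF bounded_neighbourhood[OF bounded_closure[OF supp]]])
  show "{x. glued_taylor r f x \<noteq> 0}
    \<subseteq> {x. \<exists>y\<in>closure {x. f x \<noteq> 0}. dist x y \<le> 2 * real CARD('n) * r}"
  proof
    fix x assume "x \<in> {x. glued_taylor r f x \<noteq> 0}"
    then obtain p where "taylor2 f (node r p) x \<noteq> 0" "dist x (node r p) \<le> 2 * real CARD('n) * r"
      using glue_nonzeroD[OF r, of "\<lambda>p. taylor2 f (node r p)" x] by (auto simp: glued_taylor_def)
    then show "x \<in> {x. \<exists>y\<in>closure {x. f x \<noteq> 0}. dist x y \<le> 2 * real CARD('n) * r}"
      using taylor2_eq_0_outside_support by blast
  qed
qed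

lemma jet_bound_glued_taylor:
  fixes f :: "real^'n \<Rightarrow> real"
  assumes bump: "\<And>z::real^'n. jet_bound 1 B bump z" and r: "0 < r"
    and f: "Ck_scalar 2 f" "lipschitz_hessian L f"
  shows "jet_bound r (32 * 3 ^ CARD('n) * B * (real CARD('n)) ^ 5 * L * r ^ 3)
    (\<lambda>x. glued_taylor r f x - f x) x"
proof -
  let ?n = "real CARD('n)"
  have "1 \<le> ?n" by (simp add: Suc_le_eq)
  then have "1 * r \<le> 2 * ?n * r" using r by (intro mult_right_mono) linarith+
  then have "jet_bound r (?n\<^sup>2 * L * (2 * ?n * r) ^ 3) (\<lambda>x. f x - taylor2 f (node r p) x) x"
    if "dist x (node r p) \<le> 2 * ?n * r" for p
    using r jet_bound_scale[OF jet_bound_taylor2_remainder[OF f that]] by simp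
  then have "jet_bound r (4 * 3 ^ CARD('n) * B * (?n\<^sup>2 * L * (2 * ?n * r) ^ 3))
      (glue r (\<lambda>p x. f x - taylor2 f (node r p) x)) x"
    by (intro jet_bound_glue[OF bump r] Ck_scalar_diff f smooth_taylor2[rule_format])
  moreover have "glue r (\<lambda>p x. f x - taylor2 f (node r p) x) = (\<lambda>x. f x - glued_taylor r f x)"
    using glue_const[OF r, of f] by (simp add: glue_diff glued_taylor_def fun_eq_iff)
  moreover have "4 * 3 ^ CARD('n) * B * (?n\<^sup>2 * L * (2 * ?n * r) ^ 3)
      = 32 * 3 ^ CARD('n) * B * ?n ^ 5 * L * r ^ 3"
    by (simp add: power_mult_distrib eval_nat_numeral)
  ultimately show ?thesis
    using jet_bound_minus[OF Ck_scalar_diff[OF f(1) smooth_glued_taylor[OF r, rule_format]]]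
    by fastforce
qed

text \<open>Only values at the nodes enter, so \<open>f\<close> need not be regular.\<close>

definition interp :: "real \<Rightarrow> (real^'n \<Rightarrow> real) \<Rightarrow> real^'n \<Rightarrow> real" where
  "interp r f = glue r (\<lambda>p x. f (node r p))"

lemma smooth_interp: "0 < r \<Longrightarrow> smooth (interp r f)"
  unfolding interp_def by (intro allI Ck_scalar_glue Ck_scalar_const)

lemma jet_bound_interp:
  fixes f :: "real^'n \<Rightarrow> real"
  assumes bump: "\<And>z::real^'n. jet_bound 1 B bump z" and r: "0 < r"
    and f: "\<And>z. dist x z \<le> 2 * real CARD('n) * r \<Longrightarrow> \<bar>f z - c\<bar> \<le> M"
  shows "jet_bound r (4 * 3 ^ CARD('n) * B * M) (\<lambda>x. interp r f x - c) x"
proof -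
  have "interp r f x - c = glue r (\<lambda>p x. f (node r p) - c) x" for x
    using glue_const[OF r, of "\<lambda>_::real^'n. c"] by (simp add: interp_def glue_diff)
  then show ?thesis
    using f by (simp only:) (intro jet_bound_glue[OF bump r] Ck_scalar_const jet_bound_const)
qed

definition cutoff :: "real \<Rightarrow> (real^'n) set \<Rightarrow> real^'n \<Rightarrow> real" where
  "cutoff r K = interp r (indicator {z. \<exists>y\<in>K. dist z y \<le> (2 * real CARD('n) + 1) * r})"

lemma smooth_cutoff: "0 < r \<Longrightarrow> smooth (cutoff r K)"
  unfolding cutoff_def by (rule smooth_interp)

lemma jet_bound_cutoff:
  fixes x :: "real^'n"
  assumes bump: "\<And>z::real^'n. jet_bound 1 B bump z" and r: "0 < r"
  shows "jet_bound r (4 * 3 ^ CARD('n) * B) (cutoff r K) x"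
  using jet_bound_interp[OF bump r, of x _ 0 1] by (simp add: cutoff_def indicator_def)

lemma jet_bound_cutoff_near:
  fixes x :: "real^'n"
  assumes r: "0 < r" and y: "y \<in> K" "dist x y \<le> r"
  shows "jet_bound r 0 (\<lambda>x. cutoff r K x - 1) x"
proof -
  obtain B where bump: "\<And>z::real^'n. jet_bound 1 B bump z" using ex_bump_jet_bound by blast
  have "dist z y \<le> (2 * real CARD('n) + 1) * r" if "dist x z \<le> 2 * real CARD('n) * r" for z
    using that y(2) dist_triangle3[of z y x] by (simp add: algebra_simps dist_commute)
  then have "\<bar>indicator {z. \<exists>y\<in>K. dist z y \<le> (2 * real CARD('n) + 1) * r} z - 1\<bar> \<le> (0::real)"
    if "dist x z \<le> 2 * real CARD('n) * r" for z
    using that y(1) by (auto simp: indicator_def)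
  from jet_bound_interp[OF bump r this] show ?thesis by (simp add: cutoff_def)
qed

lemma jet_bound_cutoff_far:
  fixes x :: "real^'n"
  assumes r: "0 < r" and far: "\<And>y. y \<in> K \<Longrightarrow> dist x y > (4 * real CARD('n) + 1) * r"
  shows "jet_bound r 0 (cutoff r K) x"
proof -
  obtain B where bump: "\<And>z::real^'n. jet_bound 1 B bump z" using ex_bump_jet_bound by blast
  have "\<not> dist z y \<le> (2 * real CARD('n) + 1) * r" if "dist x z \<le> 2 * real CARD('n) * r" "y \<in> K"
    for y z
    using far[OF that(2)] that(1) dist_triangle[of x y z] by (simp add: algebra_simps)
  then have "\<bar>indicator {z. \<exists>y\<in>K. dist z y \<le> (2 * real CARD('n) + 1) * r} z - 0\<bar> \<le> (0::real)"
    if "dist x z \<le> 2 * real CARD('n) * r" for z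
    using that by (auto simp: indicator_def)
  from jet_bound_interp[OF bump r this] show ?thesis by (simp add: cutoff_def)
qed

section \<open>Collapsing the critical values\<close>

definition soft_threshold :: "real \<Rightarrow> real \<Rightarrow> real \<Rightarrow> real" where
  "soft_threshold \<rho> a t = t - max (- \<rho>) (min \<rho> (t - a))"

lemma lipschitz_soft_threshold: "1-lipschitz_on UNIV (soft_threshold \<rho> a)"
  by (rule lipschitz_onI) (auto simp: soft_threshold_def dist_real_def max_def min_def)

lemma abs_soft_threshold_diff_le: "0 \<le> \<rho> \<Longrightarrow> \<bar>soft_threshold \<rho> a t - t\<bar> \<le> \<rho>"
  by (auto simp: soft_threshold_def max_def min_def)

lemma soft_threshold_near: "\<bar>t - a\<bar> \<le> \<rho> \<Longrightarrow> soft_threshold \<rho> a t = a"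
  by (auto simp: soft_threshold_def max_def min_def)

lemma ex_collapse:
  fixes S :: "real set" and \<rho> :: real
  assumes "finite S" "0 \<le> \<rho>"
  shows "\<exists>h. 1-lipschitz_on UNIV h \<and> (\<forall>t. \<bar>h t - t\<bar> \<le> card S * \<rho>) \<and>
    (\<forall>c\<in>S. \<forall>t. \<bar>t - c\<bar> \<le> \<rho> \<longrightarrow> h t = h c)"
  using assms(1)
proof (induction S)
  case empty
  show ?case by (intro exI[of _ "\<lambda>t. t"]) (auto intro: lipschitz_on_id)
next
  case (insert c S)
  then obtain h where lip: "1-lipschitz_on UNIV h" and near: "\<And>t. \<bar>h t - t\<bar> \<le> card S * \<rho>"
    and const: "\<And>c t. c \<in> S \<Longrightarrow> \<bar>t - c\<bar> \<le> \<rho> \<Longrightarrow> h t = h c" by blast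
  let ?h = "\<lambda>t. soft_threshold \<rho> (h c) (h t)"
  have "1-lipschitz_on UNIV ?h"
    using lipschitz_on_compose2[OF lip lipschitz_on_subset[OF lipschitz_soft_threshold], of \<rho> "h c"]
    by simp
  moreover have "\<bar>?h t - t\<bar> \<le> card (insert c S) * \<rho>" for t
    using near[of t] abs_soft_threshold_diff_le[OF assms(2), of "h c" "h t"] insert.hyps
    by (simp add: algebra_simps)
  moreover have "?h t = ?h c'" if "c' \<in> insert c S" "\<bar>t - c'\<bar> \<le> \<rho>" for c' t
  proof (cases "c' = c")
    case True
    have "\<bar>h t - h c\<bar> \<le> \<rho>"
      using lipschitz_onD[OF lip, of t c] that(2) True by (simp add: dist_real_def)
    then show ?thesis using True assms(2) by (simp add: soft_threshold_near)
  next
    case False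
    then show ?thesis using that const[of c' t] by simp
  qed
  ultimately show ?case by blast
qed

lemma card_integer_cube_le:
  fixes a :: real
  assumes "0 \<le> a"
  shows "card (\<Pi>\<^sub>E i\<in>(UNIV :: 'n::finite set). {\<lfloor>- a\<rfloor>..\<lfloor>a\<rfloor>}) \<le> (2 * a + 2) ^ CARD('n)"
proof -
  have "real (card (\<Pi>\<^sub>E i\<in>(UNIV :: 'n set). {\<lfloor>- a\<rfloor>..\<lfloor>a\<rfloor>})) = real (nat (\<lfloor>a\<rfloor> - \<lfloor>- a\<rfloor> + 1)) ^ CARD('n)"
    by (simp add: card_PiE add.commute)
  also have "\<dots> \<le> (2 * a + 2) ^ CARD('n)"
    using assms by (intro power_mono) linarith+
  finally show ?thesis .
qed

lemma dist_le_same_cube: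
  fixes x y :: "real^'n" and s :: real
  assumes s: "0 < s" and same: "\<And>i. \<lfloor>x $ i / s\<rfloor> = \<lfloor>y $ i / s\<rfloor>"
  shows "dist x y \<le> CARD('n) * s"
proof -
  have "\<bar>(x - y) $ i\<bar> \<le> s" for i
  proof -
    have "\<bar>x $ i / s - y $ i / s\<bar> \<le> 1" using same[of i] by linarith
    then show ?thesis using s by (simp add: abs_le_iff field_simps)
  qed
  then have "(\<Sum>i\<in>UNIV. \<bar>(x - y) $ i\<bar>) \<le> CARD('n) * s" by (rule sum_bounded_above)
  then show ?thesis using norm_le_l1_cart[of "x - y"] by (simp add: dist_norm)
qed

lemma ex_finite_net:
  fixes K :: "(real^'n) set" and R s :: real
  assumes K: "K \<subseteq> cball 0 R" and R: "0 \<le> R" and s: "0 < s"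
  shows "\<exists>Y\<subseteq>K. finite Y \<and> card Y \<le> (2 * R / s + 2) ^ CARD('n) \<and> (\<forall>y\<in>K. \<exists>z\<in>Y. dist y z \<le> CARD('n) * s)"
proof -
  define cube where "cube y = (\<lambda>i. \<lfloor>y $ i / s\<rfloor>)" for y :: "real^'n"
  let ?cubes = "\<Pi>\<^sub>E i\<in>(UNIV :: 'n set). {\<lfloor>- (R / s)\<rfloor>..\<lfloor>R / s\<rfloor>}"
  let ?Y = "inv_into K cube ` cube ` K"
  have "cube y \<in> ?cubes" if "y \<in> K" for y
  proof -
    have "\<bar>y $ i\<bar> \<le> R" for i
      using that K component_le_norm_cart[of y i] by force
    then have "- (R / s) \<le> y $ i / s" "y $ i / s \<le> R / s" for i
      using s by (auto simp: abs_le_iff divide_right_mono pos_le_divide_eq minus_le_iff)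
    then show ?thesis by (simp add: cube_def PiE_iff floor_mono)
  qed
  then have subset: "cube ` K \<subseteq> ?cubes" by blast
  have finite: "finite ?cubes" by (intro finite_PiE) auto
  have "card ?Y \<le> card (cube ` K)" using finite_subset[OF subset finite] by (rule card_image_le)
  also have "\<dots> \<le> card ?cubes" using finite subset by (rule card_mono)
  finally have "real (card ?Y) \<le> card ?cubes" by simp
  also have "\<dots> \<le> (2 * R / s + 2) ^ CARD('n)"
    using card_integer_cube_le[of "R / s", where 'n = 'n] R s by simp
  finally have "card ?Y \<le> (2 * R / s + 2) ^ CARD('n)" .
  moreover have "\<exists>z\<in>?Y. dist y z \<le> CARD('n) * s" if "y \<in> K" for y
  proof -
    have "inv_into K cube (cube y) \<in> ?Y" "cube y = cube (inv_into K cube (cube y))"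
      using that by (simp_all add: f_inv_into_f)
    then obtain z where z: "z \<in> ?Y" "cube y = cube z" by blast
    have "dist y z \<le> CARD('n) * s"
      using fun_cong[OF z(2)] by (intro dist_le_same_cube s) (simp add: cube_def)
    then show ?thesis using z(1) by blast
  qed
  moreover have "?Y \<subseteq> K" by (auto intro: inv_into_into)
  moreover have "finite ?Y" using finite_subset[OF subset finite] by (rule finite_imageI)
  ultimately show ?thesis by (intro exI[of _ ?Y]) (simp only:, blast)
qed

text \<open>About \<open>s\<^sup>-\<^sup>n\<close> cubes of side \<open>s\<close> meet \<open>K\<close>, and each has an image of diameter \<open>O(s\<^sup>m)\<close>.\<close>

lemma ex_image_cover:
  fixes f :: "real^'n \<Rightarrow> real" and A \<delta> :: real
  assumes "bounded K" and osc: "\<And>y z. y \<in> K \<Longrightarrow> z \<in> K \<Longrightarrow> \<bar>f y - f z\<bar> \<le> A * dist y z ^ m"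
    and m: "CARD('n) < m" and A: "0 \<le> A" and \<delta>: "0 < \<delta>"
  shows "\<exists>S (\<rho>::real). finite S \<and> 0 < \<rho> \<and> card S * \<rho> \<le> \<delta> \<and> (\<forall>y\<in>K. \<exists>c\<in>S. \<bar>f y - c\<bar> \<le> \<rho>)"
proof -
  let ?n = "CARD('n)"
  obtain R where R: "0 < R" "K \<subseteq> cball 0 R"
    using assms(1) by (auto simp: bounded_pos subset_iff)
  define D where "D = (2 * R + 2) ^ ?n * (A * ?n ^ m + 1)"
  define s where "s = min 1 (\<delta> / D)"
  define \<rho> where "\<rho> = (A * ?n ^ m + 1) * s ^ m"
  have "0 < A * ?n ^ m + 1" using A by (simp add: add_nonneg_pos)
  then have D: "0 < D" using R(1) by (simp add: D_def)
  then have s: "0 < s" "s \<le> 1" "D * s \<le> \<delta>"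
    using \<delta> by (auto simp: s_def min_def field_simps)
  have \<rho>: "0 < \<rho>" using s \<open>0 < A * ?n ^ m + 1\<close> by (simp add: \<rho>_def)
  obtain Y where Y: "Y \<subseteq> K" "finite Y" "card Y \<le> (2 * R / s + 2) ^ ?n"
    "\<And>y. y \<in> K \<Longrightarrow> \<exists>z\<in>Y. dist y z \<le> ?n * s"
    using ex_finite_net[OF R(2) less_imp_le[OF R(1)] s(1)] by blast
  have "card (f ` Y) * \<rho> \<le> ((2 * R + 2) / s) ^ ?n * \<rho>"
  proof (rule mult_right_mono)
    have "2 * R / s + 2 \<le> (2 * R + 2) / s" using s(1,2) by (simp add: field_simps)
    then have "(2 * R / s + 2) ^ ?n \<le> ((2 * R + 2) / s) ^ ?n"
      using R(1) s(1) by (intro power_mono) auto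
    moreover have "real (card (f ` Y)) \<le> card Y" using card_image_le[OF Y(2)] by simp
    ultimately show "card (f ` Y) \<le> ((2 * R + 2) / s) ^ ?n" using Y(3) by linarith
  qed (use \<rho> in simp)
  also have "\<dots> = D * s ^ (m - ?n)"
    using s(1) m by (simp add: D_def \<rho>_def power_divide power_diff)
  also have "\<dots> \<le> D * s"
    using D s m power_decreasing[of 1 "m - ?n" s] by (intro mult_left_mono) auto
  also note \<open>D * s \<le> \<delta>\<close>
  finally have "card (f ` Y) * \<rho> \<le> \<delta>" .
  moreover have "\<exists>c\<in>f ` Y. \<bar>f y - c\<bar> \<le> \<rho>" if y: "y \<in> K" for y
  proof -
    obtain z where z: "z \<in> Y" "dist y z \<le> ?n * s" using Y(4)[OF y] by blast
    have "\<bar>f y - f z\<bar> \<le> A * dist y z ^ m" using z(1) Y(1) y by (intro osc) auto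
    also have "\<dots> \<le> A * (?n * s) ^ m" using z(2) A by (intro mult_left_mono power_mono) auto
    also have "\<dots> \<le> \<rho>" using s(1) by (simp add: \<rho>_def power_mult_distrib algebra_simps)
    finally show ?thesis using z(1) by blast
  qed
  ultimately show ?thesis using \<rho> Y(2) by (intro exI[of _ "f ` Y"] exI[of _ \<rho>]) auto
qed

lemma ex_locally_constant_collapse:
  fixes f :: "real^'n \<Rightarrow> real" and A \<delta> :: real
  assumes "bounded K" and osc: "\<And>x y. y \<in> K \<Longrightarrow> \<bar>f x - f y\<bar> \<le> A * dist x y ^ m"
    and m: "CARD('n) < m" and A: "0 \<le> A" and \<delta>: "0 < \<delta>"
  shows "\<exists>H. (\<forall>x. \<bar>H x - f x\<bar> \<le> \<delta>) \<and> (\<forall>y\<in>K. \<forall>x. \<bar>H x - H y\<bar> \<le> A * dist x y ^ m) \<and>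
    (\<exists>d>0. \<forall>y\<in>K. \<forall>x. dist x y \<le> d \<longrightarrow> H x = H y)"
proof -
  have "0 < \<delta> / 2" using \<delta> by simp
  from ex_image_cover[OF assms(1) osc m A this]
  obtain S and \<rho> :: real where S: "finite S" "0 < \<rho>" "card S * \<rho> \<le> \<delta> / 2"
    and cover: "\<forall>y\<in>K. \<exists>c\<in>S. \<bar>f y - c\<bar> \<le> \<rho>" by blast
  obtain h where lip: "1-lipschitz_on UNIV h" and near: "\<And>t. \<bar>h t - t\<bar> \<le> card S * (2 * \<rho>)"
    and const: "\<And>c t. c \<in> S \<Longrightarrow> \<bar>t - c\<bar> \<le> 2 * \<rho> \<Longrightarrow> h t = h c"
    using ex_collapse[OF S(1), of "2 * \<rho>"] S(2) by auto
  define d where "d = min 1 (\<rho> / (A + 1))"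
  have d: "0 < d" "d \<le> 1" "A * d \<le> \<rho>"
    using A S(2) by (auto simp: d_def min_def field_simps)
  have close: "\<bar>h (f x) - f x\<bar> \<le> \<delta>" for x using near[of "f x"] S(3) by simp
  have oscillation: "\<bar>h (f x) - h (f y)\<bar> \<le> A * dist x y ^ m" if "y \<in> K" for x y
    using lipschitz_onD[OF lip, of "f x" "f y"] osc[OF that, of x] by (simp add: dist_real_def)
  have locally_const: "h (f x) = h (f y)" if y: "y \<in> K" and x: "dist x y \<le> d" for x y
  proof -
    have "dist x y ^ m \<le> d ^ m" using x by (intro power_mono) auto
    also have "\<dots> \<le> d" using d m power_decreasing[of 1 m d] by simp
    finally have "A * dist x y ^ m \<le> \<rho>" using A d(3) mult_left_mono[of _ d A] by fastforce
    then have "\<bar>f x - f y\<bar> \<le> \<rho>" using osc[OF y, of x] by linarith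
    moreover obtain c where "c \<in> S" "\<bar>f y - c\<bar> \<le> \<rho>" using cover y by blast
    ultimately have "h (f x) = h c" "h (f y) = h c" using S(2) by (auto intro!: const)
    then show ?thesis by simp
  qed
  show ?thesis
    by (rule exI[of _ "\<lambda>x. h (f x)"])
        (intro conjI allI ballI impI exI[of _ d] close oscillation locally_const d(1))
qed

section \<open>Multiscale interpolation\<close>

definition locally_constant_near :: "(real^'n) set \<Rightarrow> (real^'n \<Rightarrow> real) \<Rightarrow> bool" where
  "locally_constant_near K f \<longleftrightarrow> (\<exists>U. open U \<and> K \<subseteq> U \<and> (\<forall>x\<in>U. \<forall>i. \<partial> i f x = 0))"

text \<open>The dimension is a real parameter \<open>n\<close> because a constant whose type does not mention \<open>'n\<close>
cannot be defined in terms of \<open>CARD('n)\<close>.\<close>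

locale multiscale =
  fixes K :: "(real^'n) set" and H :: "real^'n \<Rightarrow> real" and A B n C :: real
  assumes n_eq: "n = real CARD('n)" and C_eq: "C = 4 * 3 ^ CARD('n) * B"
    and bump_jet_bound: "\<And>z::real^'n. jet_bound 1 B bump z"
    and cubic: "\<And>x y. y \<in> K \<Longrightarrow> \<bar>H x - H y\<bar> \<le> A * dist x y ^ 3"
    and A_nonneg: "0 \<le> A"
begin

lemma n_ge_1: "1 \<le> n"
  by (simp add: n_eq Suc_le_eq)

lemma C_nonneg: "0 \<le> C"
  using jet_bound_nonneg[OF bump_jet_bound] by (simp add: C_eq)

lemmas jet_bound_interp_C = jet_bound_interp[OF bump_jet_bound, folded n_eq C_eq]
lemmas jet_bound_cutoff_C = jet_bound_cutoff[OF bump_jet_bound, folded C_eq]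

lemma jet_bound_interp_near:
  assumes r: "0 < r" and y: "y \<in> K" "dist x y \<le> d"
  shows "jet_bound r (C * (A * (d + 2 * n * r) ^ 3)) (\<lambda>x. interp r H x - H y) x"
proof (rule jet_bound_interp_C[OF r])
  fix z assume "dist x z \<le> 2 * n * r"
  then have "dist z y \<le> d + 2 * n * r" using y(2) dist_triangle[of z y x] by (simp add: dist_commute)
  then have "A * dist z y ^ 3 \<le> A * (d + 2 * n * r) ^ 3"
    using A_nonneg by (intro mult_left_mono power_mono) auto
  then show "\<bar>H z - H y\<bar> \<le> A * (d + 2 * n * r) ^ 3" using cubic[OF y(1), of z] by linarith
qed

definition blend :: "real \<Rightarrow> (real^'n \<Rightarrow> real) \<Rightarrow> real^'n \<Rightarrow> real" where
  "blend r f x = f x + cutoff r K x * (interp r H x - f x)"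

lemma Ck_scalar_blend: "0 < r \<Longrightarrow> Ck_scalar k f \<Longrightarrow> Ck_scalar k (blend r f)"
  unfolding blend_def
  by (intro Ck_scalar_add Ck_scalar_mult Ck_scalar_diff smooth_cutoff[rule_format]
      smooth_interp[rule_format])

lemma jet_bound_blend_far:
  assumes r: "0 < r" and f: "Ck_scalar 2 f" and far: "\<And>y. y \<in> K \<Longrightarrow> dist x y > (4 * n + 1) * r"
  shows "jet_bound r 0 (\<lambda>x. blend r f x - f x) x"
proof -
  have "jet_bound r 0 (\<lambda>x. cutoff r K x * (interp r H x - f x)) x"
    using r smooth_cutoff[OF r] smooth_interp[OF r]
    by (intro jet_bound_mult_0 jet_bound_cutoff_far Ck_scalar_diff f far[unfolded n_eq]) auto
  then show ?thesis by (simp add: blend_def)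
qed

lemma jet_bound_blend_near:
  assumes r: "0 < r" and f: "Ck_scalar 2 f" and y: "y \<in> K" "dist x y \<le> r"
  shows "jet_bound r 0 (\<lambda>x. blend r f x - interp r H x) x"
proof -
  have "jet_bound r 0 (\<lambda>x. (cutoff r K x - 1) * (interp r H x - f x)) x"
    using r smooth_cutoff[OF r] smooth_interp[OF r]
    by (intro jet_bound_mult_0 jet_bound_cutoff_near[OF r y] Ck_scalar_diff f Ck_scalar_const) auto
  then show ?thesis by (simp add: blend_def algebra_simps)
qed

lemma bounded_support_blend:
  assumes "bounded K" "0 < r" "Ck_scalar 2 f" "bounded {x. f x \<noteq> 0}"
  shows "bounded {x. blend r f x \<noteq> 0}"
proof -
  have "blend r f x = f x" if "\<And>y. y \<in> K \<Longrightarrow> dist x y > (4 * n + 1) * r" for x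
    using jet_bound_0D(1)[OF jet_bound_blend_far[OF assms(2,3) that] assms(2)] by simp
  then have "{x. blend r f x \<noteq> 0} \<subseteq> {x. f x \<noteq> 0} \<union> {x. \<exists>y\<in>K. dist x y \<le> (4 * n + 1) * r}"
    by (auto simp: not_le[symmetric])
  moreover have "bounded ({x. f x \<noteq> 0} \<union> {x. \<exists>y\<in>K. dist x y \<le> (4 * n + 1) * r})"
    using assms(4) bounded_neighbourhood[OF assms(1)] by (rule bounded_Un[THEN iffD2, OF conjI])
  ultimately show ?thesis by (rule bounded_subset[rotated])
qed

text \<open>Beyond distance \<open>(4 n + 1) r\<close> from \<open>K\<close> the cutoff function at scale \<open>r\<close> vanishes.\<close>

definition tracks :: "real \<Rightarrow> real \<Rightarrow> (real^'n \<Rightarrow> real) \<Rightarrow> bool" where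
  "tracks M r f \<longleftrightarrow>
    (\<forall>y\<in>K. \<forall>x. dist x y \<le> (4 * n + 1) * r \<longrightarrow> jet_bound r (M * r ^ 3) (\<lambda>x. f x - H y) x)"

lemma tracks_smooth_approx:
  assumes r: "0 < r" and C2: "Ck_scalar 2 f" "Ck_scalar 2 g"
    and f: "\<And>x. jet_bound r (D * r ^ 3) (\<lambda>x. f x - g x) x" and H: "\<And>x. \<bar>H x - g x\<bar> \<le> r ^ 3"
    and g: "\<And>x y d. y \<in> K \<Longrightarrow> dist x y \<le> d \<Longrightarrow> jet_bound d (A * d ^ 3) (\<lambda>x. g x - g y) x"
  shows "tracks (D + A * (4 * n + 1) ^ 3 + 1) r f"
  unfolding tracks_def
proof (intro ballI allI impI)
  fix x y assume y: "y \<in> K" "dist x y \<le> (4 * n + 1) * r"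
  have "1 * r \<le> (4 * n + 1) * r" using r n_ge_1 by (intro mult_right_mono) auto
  then have "jet_bound r (A * (4 * n + 1) ^ 3 * r ^ 3) (\<lambda>x. g x - g y) x"
    using jet_bound_scale[OF g[OF y]] r by (simp add: power_mult_distrib mult.assoc)
  moreover have "jet_bound r (r ^ 3) (\<lambda>x. g y - H y) x"
    using H[of y] by (intro jet_bound_const) (simp add: abs_minus_commute)
  ultimately have "jet_bound r (D * r ^ 3 + A * (4 * n + 1) ^ 3 * r ^ 3 + r ^ 3)
      (\<lambda>x. (f x - g x) + (g x - g y) + (g y - H y)) x"
    using f r by (intro jet_bound_add[of "\<lambda>x. _ x + _ x"] jet_bound_add[of "\<lambda>x. f x - g x"]
      Ck_scalar_add Ck_scalar_diff Ck_scalar_const C2) auto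
  then show "jet_bound r ((D + A * (4 * n + 1) ^ 3 + 1) * r ^ 3) (\<lambda>x. f x - H y) x"
    by (simp add: algebra_simps)
qed

lemma tracks_mono: "tracks M r f \<Longrightarrow> M \<le> M' \<Longrightarrow> 0 \<le> r \<Longrightarrow> tracks M' r f"
  unfolding tracks_def by (meson jet_bound_mono mult_right_mono zero_le_power)

definition step_const :: "real \<Rightarrow> real" where
  "step_const M = 4 * C * (C * (A * (6 * n + 1) ^ 3) + M)"

lemma step_const_nonneg: "0 \<le> M \<Longrightarrow> 0 \<le> step_const M"
  using C_nonneg A_nonneg n_ge_1 by (simp add: step_const_def)

lemma jet_bound_blend:
  assumes r: "0 < r" and f: "Ck_scalar 2 f" "tracks M r f" and M: "0 \<le> M"
  shows "jet_bound r (step_const M * r ^ 3) (\<lambda>x. blend r f x - f x) x"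
proof (cases "\<exists>y\<in>K. dist x y \<le> (4 * n + 1) * r")
  case False
  then have "jet_bound r 0 (\<lambda>x. blend r f x - f x) x"
    using r f by (intro jet_bound_blend_far) (auto simp: not_le)
  then show ?thesis
    by (rule jet_bound_mono) (use r step_const_nonneg[OF M] in simp)
next
  case True
  then obtain y where y: "y \<in> K" "dist x y \<le> (4 * n + 1) * r" by blast
  let ?M = "(C * (A * (6 * n + 1) ^ 3) + M) * r ^ 3"
  note C2 = smooth_interp[OF r, rule_format] smooth_cutoff[OF r, rule_format] Ck_scalar_diff
    Ck_scalar_const f(1)
  have "(4 * n + 1) * r + 2 * n * r = (6 * n + 1) * r" by (simp add: algebra_simps)
  then have "jet_bound r (C * (A * (6 * n + 1) ^ 3) * r ^ 3) (\<lambda>x. interp r H x - H y) x"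
    using jet_bound_interp_near[OF r y] by (simp add: power_mult_distrib mult.assoc)
  moreover have "jet_bound r (M * r ^ 3) (\<lambda>x. f x - H y) x"
    using f(2) y by (simp add: tracks_def)
  ultimately have "jet_bound r ?M (\<lambda>x. (interp r H x - H y) - (f x - H y)) x"
    using r unfolding distrib_right by (intro jet_bound_diff C2) auto
  moreover have "jet_bound r C (cutoff r K) x"
    by (rule jet_bound_cutoff_C[OF r])
  ultimately have "jet_bound r (4 * C * ?M)
      (\<lambda>x. cutoff r K x * ((interp r H x - H y) - (f x - H y))) x"
    using r by (intro jet_bound_mult C2) auto
  then show ?thesis by (simp add: blend_def step_const_def mult.assoc)
qed

definition tracking_const :: real where
  "tracking_const = C * (A * ((2 * n + 1) * (4 * n + 1)) ^ 3)"

lemma tracking_const_nonneg: "0 \<le> tracking_const"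
  using C_nonneg A_nonneg n_ge_1 by (simp add: tracking_const_def)

lemma tracks_blend:
  assumes r: "0 < r" and s: "(4 * n + 1) * s = r" and f: "Ck_scalar 2 f" and M: "tracking_const \<le> M"
  shows "tracks M s (blend r f)"
  unfolding tracks_def
proof (intro ballI allI impI)
  fix x y assume y: "y \<in> K" "dist x y \<le> (4 * n + 1) * s"
  then have x: "dist x y \<le> r" using s by simp
  have "0 < s" using r zero_less_mult_pos[of "4 * n + 1" s] n_ge_1 by (simp add: s)
  moreover have "s \<le> r" using \<open>0 < s\<close> n_ge_1 unfolding s[symmetric] by (simp add: algebra_simps)
  ultimately have s_pos: "0 \<le> s" "s \<le> r" by simp_all
  note C2 = smooth_interp[OF r, rule_format] Ck_scalar_blend[OF r f] Ck_scalar_diff Ck_scalar_const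
  have "jet_bound r 0 (\<lambda>x. blend r f x - interp r H x) x"
    by (rule jet_bound_blend_near[OF r f y(1) x])
  moreover have "r + 2 * n * r = (2 * n + 1) * (4 * n + 1) * s"
    unfolding s[symmetric] by (simp add: algebra_simps)
  then have "jet_bound r (tracking_const * s ^ 3) (\<lambda>x. interp r H x - H y) x"
    using jet_bound_interp_near[OF r y(1) x]
    by (simp add: tracking_const_def power_mult_distrib mult.assoc)
  ultimately have "jet_bound r (0 + tracking_const * s ^ 3)
      (\<lambda>x. (blend r f x - interp r H x) + (interp r H x - H y)) x"
    using r by (intro jet_bound_add C2) auto
  then have "jet_bound s (tracking_const * s ^ 3) (\<lambda>x. blend r f x - H y) x"
    using jet_bound_scale[OF _ s_pos] by simp
  then show "jet_bound s (M * s ^ 3) (\<lambda>x. blend r f x - H y) x"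
    by (rule jet_bound_mono) (use M s_pos in \<open>auto intro: mult_right_mono\<close>)
qed

definition scale :: "real \<Rightarrow> nat \<Rightarrow> real" where
  "scale r k = r / (4 * n + 1) ^ k"

lemma scale_0 [simp]: "scale r 0 = r"
  by (simp add: scale_def)

lemma scale_Suc: "(4 * n + 1) * scale r (Suc k) = scale r k"
  using n_ge_1 by (simp add: scale_def)

lemma scale_pos: "0 < r \<Longrightarrow> 0 < scale r k"
  using n_ge_1 by (simp add: scale_def)

lemma scale_Suc_le: "0 < r \<Longrightarrow> 2 * scale r (Suc k) \<le> scale r k"
proof -
  assume "0 < r"
  have "2 \<le> 4 * n + 1" using n_ge_1 by simp
  then show ?thesis
    using mult_right_mono[OF _ less_imp_le[OF scale_pos[OF \<open>0 < r\<close>]], of 2 "4 * n + 1" "Suc k"]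
      scale_Suc[of r k]
    by simp
qed

lemma scale_le: "0 < r \<Longrightarrow> scale r k \<le> r"
proof (induction k)
  case (Suc k)
  then show ?case using scale_Suc_le[of r k] scale_pos[of r "Suc k"] by simp
qed simp

lemma ex_scale_le:
  assumes "0 < d"
  shows "\<exists>k. scale r k \<le> d"
proof -
  have "1 < 4 * n + 1" using n_ge_1 by simp
  then obtain k where "r / d < (4 * n + 1) ^ k" using real_arch_pow by blast
  then have "scale r k \<le> d"
    using assms n_ge_1 by (simp add: scale_def pos_divide_less_eq pos_divide_le_eq mult.commute)
  then show ?thesis ..
qed

primrec refine :: "real \<Rightarrow> (real^'n \<Rightarrow> real) \<Rightarrow> nat \<Rightarrow> real^'n \<Rightarrow> real" where
  "refine r f 0 = f"
| "refine r f (Suc k) = blend (scale r k) (refine r f k)"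

lemma Ck_scalar_refine: "0 < r \<Longrightarrow> Ck_scalar l f \<Longrightarrow> Ck_scalar l (refine r f k)"
  by (induction k) (auto intro: Ck_scalar_blend scale_pos)

lemma bounded_support_refine:
  assumes "bounded K" "0 < r" "Ck_scalar 2 f" "bounded {x. f x \<noteq> 0}"
  shows "bounded {x. refine r f k x \<noteq> 0}"
  using assms by (induction k) (auto intro!: bounded_support_blend scale_pos Ck_scalar_refine)

lemma tracks_refine:
  assumes "0 < r" "Ck_scalar 2 f" "tracks M r f" "tracking_const \<le> M"
  shows "tracks M (scale r k) (refine r f k)"
  using assms by (cases k) (auto intro!: tracks_blend scale_pos scale_Suc Ck_scalar_refine)

text \<open>The first \<open>k\<close> scales sum to at most \<open>2 (r - scale r k)\<close>.\<close>

lemma jet_bound_refine: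
  assumes r: "0 < r" "r \<le> 1" and f: "Ck_scalar 2 f" "tracks M r f" and M: "tracking_const \<le> M"
  shows "jet_bound 1 (2 * step_const M * (r - scale r k)) (\<lambda>x. refine r f k x - f x) x"
proof (induction k)
  case 0
  show ?case by (simp add: jet_bound_const)
next
  case (Suc k)
  have M_nonneg: "0 \<le> M" using M tracking_const_nonneg by linarith
  note C2 = Ck_scalar_refine[OF r(1) f(1)]
  have "jet_bound (scale r k) (step_const M * scale r k ^ 3)
    (\<lambda>x. refine r f (Suc k) x - refine r f k x) x"
    using tracks_refine[OF r(1) f M] scale_pos[OF r(1)] by (simp add: jet_bound_blend C2 M_nonneg)
  then have "jet_bound 1 (step_const M * scale r k) (\<lambda>x. refine r f (Suc k) x - refine r f k x) x"
    using scale_pos[OF r(1)] scale_le[OF r(1), of k] r(2) by (intro jet_bound_unscale_cubic) auto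
  from jet_bound_add[OF _ _ this Suc.IH]
  have "jet_bound 1 (step_const M * scale r k + 2 * step_const M * (r - scale r k))
    (\<lambda>x. refine r f (Suc k) x - f x) x"
    using C2 by (simp add: Ck_scalar_diff f(1) del: refine.simps)
  moreover have "step_const M * (2 * scale r (Suc k)) \<le> step_const M * scale r k"
    using step_const_nonneg[OF M_nonneg] scale_Suc_le[OF r(1)] by (rule mult_left_mono[rotated])
  ultimately show ?case
    by (elim jet_bound_mono) (simp add: algebra_simps)
qed

lemma partial_deriv_refine_eq_0:
  assumes r: "0 < r" and f: "Ck_scalar 2 f"
    and const: "\<And>x. dist x y \<le> (2 * n + 1) * scale r k \<Longrightarrow> H x = H y"
    and y: "y \<in> K" "dist x y \<le> scale r k"
  shows "\<partial> i (refine r f (Suc k)) x = 0"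
proof -
  let ?r = "scale r k" and ?f = "refine r f (Suc k)"
  note r_pos = scale_pos[OF r, of k]
  note C2 = smooth_interp[OF r_pos, rule_format] Ck_scalar_refine[OF r f] Ck_scalar_diff
    Ck_scalar_const
  have "\<bar>H z - H y\<bar> \<le> 0" if "dist x z \<le> 2 * n * ?r" for z
    using const[of z] that y(2) dist_triangle[of z y x] by (simp add: dist_commute algebra_simps)
  from jet_bound_interp_C[OF r_pos this]
  have "jet_bound ?r 0 (\<lambda>x. interp ?r H x - H y) x" by simp
  moreover have "jet_bound ?r 0 (\<lambda>x. ?f x - interp ?r H x) x"
    using jet_bound_blend_near[OF r_pos Ck_scalar_refine[OF r f] y] by simp
  ultimately have "jet_bound ?r (0 + 0) (\<lambda>x. (interp ?r H x - H y) + (?f x - interp ?r H x)) x"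
    using r_pos by (intro jet_bound_add C2) auto
  then have "\<partial> i (\<lambda>x. ?f x - H y) x = 0"
    using jet_bound_0D(2)[OF _ r_pos] by (simp del: refine.simps)
  then show ?thesis
    using Ck_scalar_2D(1)[OF Ck_scalar_refine[OF r f]]
    by (simp add: partial_deriv_diff del: refine.simps)
qed

lemma ex_refinement_locally_constant:
  assumes r: "0 < r" "r \<le> 1" and f: "smooth f" "bounded {x. f x \<noteq> 0}" "tracks M r f"
    and M: "tracking_const \<le> M" and K: "bounded K"
    and d: "0 < d" and const: "\<And>x y. y \<in> K \<Longrightarrow> dist x y \<le> d \<Longrightarrow> H x = H y"
  shows "\<exists>g. smooth g \<and> bounded {x. g x \<noteq> 0} \<and> locally_constant_near K g \<and>
    (\<forall>x. jet_bound 1 (2 * step_const M * r) (\<lambda>x. g x - f x) x)"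
proof -
  have "0 < d / (2 * n + 1)" using d n_ge_1 by simp
  then obtain k where "scale r k \<le> d / (2 * n + 1)" using ex_scale_le by blast
  then have k: "(2 * n + 1) * scale r k \<le> d" using n_ge_1 by (simp add: pos_le_divide_eq mult.commute)
  let ?g = "refine r f (Suc k)"
  have C2: "Ck_scalar 2 f" using f(1) by blast
  have "smooth ?g" using Ck_scalar_refine r(1) f(1) by blast
  moreover have "bounded {x. ?g x \<noteq> 0}" by (rule bounded_support_refine[OF K r(1) C2 f(2)])
  moreover have "locally_constant_near K ?g"
    unfolding locally_constant_near_def
  proof (intro exI conjI ballI allI)
    let ?U = "\<Union>y\<in>K. ball y (scale r k)"
    show "open ?U" by blast
    show "K \<subseteq> ?U" using scale_pos[OF r(1)] by fastforce
    fix x i assume "x \<in> ?U"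
    then obtain y where y: "y \<in> K" "dist x y \<le> scale r k"
      by (auto simp: dist_commute intro: less_imp_le)
    show "\<partial> i ?g x = 0"
      using k by (intro partial_deriv_refine_eq_0[OF r(1) C2 _ y] const[OF y(1)]) simp
  qed
  moreover have "jet_bound 1 (2 * step_const M * r) (\<lambda>x. ?g x - f x) x" for x
  proof (rule jet_bound_mono[OF jet_bound_refine[OF r C2 f(3) M]])
    have "0 \<le> step_const M" using M tracking_const_nonneg by (intro step_const_nonneg) linarith
    then show "2 * step_const M * (r - scale r (Suc k)) \<le> 2 * step_const M * r"
      using scale_pos[OF r(1), of "Suc k"] by (intro mult_left_mono) auto
  qed
  ultimately show ?thesis by blast
qed

lemma ex_refined_approx:
  assumes r: "0 < r" "r \<le> 1" and K: "bounded K" and f: "smooth f" "bounded {x. f x \<noteq> 0}"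
    and close: "\<And>x. jet_bound r (D * r ^ 3) (\<lambda>x. f x - \<psi> x) x" "\<And>x. \<bar>H x - \<psi> x\<bar> \<le> r ^ 3"
    and D: "0 \<le> D"
    and \<psi>: "Ck_scalar 2 \<psi>" "\<And>x y d. y \<in> K \<Longrightarrow> dist x y \<le> d \<Longrightarrow> jet_bound d (A * d ^ 3) (\<lambda>x. \<psi> x - \<psi> y) x"
    and const: "0 < d" "\<And>x y. y \<in> K \<Longrightarrow> dist x y \<le> d \<Longrightarrow> H x = H y"
  defines "M \<equiv> tracking_const + (D + A * (4 * n + 1) ^ 3 + 1)"
  shows "\<exists>g. smooth g \<and> bounded {x. g x \<noteq> 0} \<and> locally_constant_near K g \<and>
    (\<forall>x. jet_bound 1 ((2 * step_const M + D) * r) (\<lambda>x. g x - \<psi> x) x)"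
proof -
  have "tracks (D + A * (4 * n + 1) ^ 3 + 1) r f"
    using f(1) by (intro tracks_smooth_approx[OF r(1) _ \<psi>(1) close \<psi>(2)]) blast
  then have "tracks M r f"
    unfolding M_def by (rule tracks_mono) (use tracking_const_nonneg r in auto)
  moreover have "tracking_const \<le> M" using D A_nonneg n_ge_1 by (simp add: M_def)
  ultimately obtain g where g: "smooth g" "bounded {x. g x \<noteq> 0}" "locally_constant_near K g"
    and refined: "\<And>x. jet_bound 1 (2 * step_const M * r) (\<lambda>x. g x - f x) x"
    using ex_refinement_locally_constant[OF r f _ _ K const] by blast
  have "jet_bound 1 ((2 * step_const M + D) * r) (\<lambda>x. g x - \<psi> x) x" for x
    using jet_bound_add[OF _ _ refined jet_bound_unscale_cubic[OF close(1) r]] g(1) f(1) \<psi>(1)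
    by (simp add: algebra_simps Ck_scalar_diff)
  then show ?thesis using g by blast
qed

end

lemma ex_approx_locally_constant_near_at_scale:
  fixes \<psi> :: "real^'n \<Rightarrow> real"
  assumes dim: "CARD('n) < 3"
    and \<psi>: "Ck_scalar 2 \<psi>" "lipschitz_hessian L \<psi>" "bounded {x. \<psi> x \<noteq> 0}"
    and K: "bounded K" and crit: "\<And>y i. y \<in> K \<Longrightarrow> \<partial> i \<psi> y = 0" "\<And>y i j. y \<in> K \<Longrightarrow> \<partial> i (\<partial> j \<psi>) y = 0"
  shows "\<exists>E. \<forall>r. 0 < r \<longrightarrow> r \<le> 1 \<longrightarrow> (\<exists>g. smooth g \<and> bounded {x. g x \<noteq> 0} \<and> locally_constant_near K g \<and>
    (\<forall>x. jet_bound 1 (E * r) (\<lambda>x. g x - \<psi> x) x))"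
proof -
  obtain B where bump: "\<And>z::real^'n. jet_bound 1 B bump z" using ex_bump_jet_bound by blast
  define n C A D where "n = real CARD('n)" and "C = 4 * 3 ^ CARD('n) * B" and "A = n\<^sup>2 * L"
    and "D = 32 * 3 ^ CARD('n) * B * n ^ 5 * L"
  define E where "E = 2 * multiscale.step_const A n C
    (multiscale.tracking_const A n C + (D + A * (4 * n + 1) ^ 3 + 1)) + D"
  have nonneg: "0 \<le> A" "0 \<le> D"
    using lipschitz_hessian_nonneg[OF \<psi>(2)] jet_bound_nonneg[OF bump]
    by (simp_all add: A_def D_def n_def)
  have near: "jet_bound d (A * d ^ 3) (\<lambda>x. \<psi> x - \<psi> y) x" if "y \<in> K" "dist x y \<le> d" for x y d
    unfolding A_def n_def using that by (intro jet_bound_near_critical_point \<psi> crit)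
  have cubic: "\<bar>\<psi> x - \<psi> y\<bar> \<le> A * dist x y ^ 3" if "y \<in> K" for x y
    using jet_boundD(1)[OF near[OF that order_refl]] .
  have "\<exists>g. smooth g \<and> bounded {x. g x \<noteq> 0} \<and> locally_constant_near K g \<and>
      (\<forall>x. jet_bound 1 (E * r) (\<lambda>x. g x - \<psi> x) x)" if r: "0 < r" "r \<le> 1" for r
  proof -
    obtain H d where H: "\<And>x. \<bar>H x - \<psi> x\<bar> \<le> r ^ 3" "\<And>x y. y \<in> K \<Longrightarrow> \<bar>H x - H y\<bar> \<le> A * dist x y ^ 3"
      and d: "0 < d" "\<And>x y. y \<in> K \<Longrightarrow> dist x y \<le> d \<Longrightarrow> H x = H y"
      using ex_locally_constant_collapse[OF K cubic dim nonneg(1) zero_less_power[OF r(1)]] by metis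
    have close: "jet_bound r (D * r ^ 3) (\<lambda>x. glued_taylor r \<psi> x - \<psi> x) x" for x
      unfolding D_def n_def by (rule jet_bound_glued_taylor[OF bump r(1) \<psi>(1,2)])
    interpret multiscale K H A B n C
      by unfold_locales (use n_def C_def bump H(2) nonneg(1) in auto)
    show ?thesis
      unfolding E_def by (rule ex_refined_approx[OF r K smooth_glued_taylor[OF r(1)]
          bounded_support_glued_taylor[OF r(1) \<psi>(3)] close H(1) nonneg(2) \<psi>(1) near d])
  qed
  then show ?thesis by blast
qed

lemma ex_approx_locally_constant_near:
  fixes \<psi> :: "real^'n \<Rightarrow> real"
  assumes "CARD('n) < 3"
    and "Ck_scalar 2 \<psi>" "lipschitz_hessian L \<psi>" "bounded {x. \<psi> x \<noteq> 0}"
    and "bounded K" "\<And>y i. y \<in> K \<Longrightarrow> \<partial> i \<psi> y = 0" "\<And>y i j. y \<in> K \<Longrightarrow> \<partial> i (\<partial> j \<psi>) y = 0"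
    and \<epsilon>: "0 < \<epsilon>"
  shows "\<exists>g. smooth g \<and> bounded {x. g x \<noteq> 0} \<and> locally_constant_near K g \<and>
    (\<forall>x. jet_bound 1 \<epsilon> (\<lambda>x. g x - \<psi> x) x)"
proof -
  obtain E where E: "\<And>r. 0 < r \<Longrightarrow> r \<le> 1 \<Longrightarrow> \<exists>g. smooth g \<and> bounded {x. g x \<noteq> 0} \<and>
      locally_constant_near K g \<and> (\<forall>x. jet_bound 1 (E * r) (\<lambda>x. g x - \<psi> x) x)"
    using ex_approx_locally_constant_near_at_scale[OF assms(1-7)] by blast
  define r where "r = min 1 (\<epsilon> / (\<bar>E\<bar> + 1))"
  have r: "0 < r" "r \<le> 1" using \<epsilon> by (auto simp: r_def)
  have "E * r \<le> (\<bar>E\<bar> + 1) * (\<epsilon> / (\<bar>E\<bar> + 1))" using r \<epsilon> by (intro mult_mono) (auto simp: r_def)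
  also have "\<dots> = \<epsilon>" by simp
  finally show ?thesis using E[OF r] jet_bound_mono by blast
qed

section \<open>Potentials and stream functions\<close>

text \<open>Poincare's lemma on a vector space, with the potential given by integration along rays.\<close>

lemma has_derivative_inner_along_ray:
  fixes g :: "'a::real_inner \<Rightarrow> 'a" and g' :: "'a \<Rightarrow> 'a \<Rightarrow>\<^sub>L 'a" and t :: real
  assumes g: "\<And>x. (g has_derivative g' x) (at x)" and sym: "\<And>x h k. g' x h \<bullet> k = g' x k \<bullet> h"
  shows "((\<lambda>x. g (t *\<^sub>R x) \<bullet> x) has_derivative
    blinfun_inner_right (g (t *\<^sub>R x) + t *\<^sub>R g' (t *\<^sub>R x) x)) (at x)"
proof -
  have "((\<lambda>x. g (t *\<^sub>R x)) has_derivative (\<lambda>h. g' (t *\<^sub>R x) (t *\<^sub>R h))) (at x)"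
    by (rule has_derivative_compose[OF _ g]) (auto intro!: derivative_eq_intros)
  moreover have
    "g (t *\<^sub>R x) \<bullet> h + g' (t *\<^sub>R x) (t *\<^sub>R h) \<bullet> x = (g (t *\<^sub>R x) + t *\<^sub>R g' (t *\<^sub>R x) x) \<bullet> h" for h
    by (simp add: inner_add_left blinfun.scaleR_right sym[of _ h x])
  ultimately show ?thesis using has_derivative_inner[OF _ has_derivative_ident] by fastforce
qed

lemma has_integral_derivative_along_ray:
  fixes g :: "'a::banach \<Rightarrow> 'a" and g' :: "'a \<Rightarrow> 'a \<Rightarrow>\<^sub>L 'a"
  assumes g: "\<And>x. (g has_derivative g' x) (at x)"
  shows "((\<lambda>t. g (t *\<^sub>R x) + t *\<^sub>R g' (t *\<^sub>R x) x) has_integral g x) {0..1}"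
proof -
  have "((\<lambda>t. t *\<^sub>R g (t *\<^sub>R x)) has_vector_derivative g (t *\<^sub>R x) + t *\<^sub>R g' (t *\<^sub>R x) x)
    (at t within {0..1})" for t :: real
    unfolding has_vector_derivative_def
  proof (rule has_derivative_at_withinI)
    have "((\<lambda>t. g (t *\<^sub>R x)) has_derivative (\<lambda>s. g' (t *\<^sub>R x) (s *\<^sub>R x))) (at t)"
      by (rule has_derivative_compose[OF _ g]) (auto intro!: derivative_eq_intros)
    from has_derivative_scaleR[OF has_derivative_ident this]
    show "((\<lambda>t. t *\<^sub>R g (t *\<^sub>R x)) has_derivative (\<lambda>s. s *\<^sub>R (g (t *\<^sub>R x) + t *\<^sub>R g' (t *\<^sub>R x) x)))
      (at t)"
      by (simp add: blinfun.scaleR_right algebra_simps)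
  qed
  then show ?thesis
    using fundamental_theorem_of_calculus[of 0 1 "\<lambda>t. t *\<^sub>R g (t *\<^sub>R x)"] by fastforce
qed

lemma has_derivative_ray_integral:
  fixes g :: "'a::{real_inner, banach} \<Rightarrow> 'a" and g' :: "'a \<Rightarrow> 'a \<Rightarrow>\<^sub>L 'a"
  assumes g: "\<And>x. (g has_derivative g' x) (at x)" and cont: "continuous_on UNIV g'"
    and sym: "\<And>x h k. g' x h \<bullet> k = g' x k \<bullet> h"
  shows "((\<lambda>x. integral {0..1} (\<lambda>t. g (t *\<^sub>R x) \<bullet> x)) has_derivative (\<lambda>h. g x \<bullet> h)) (at x)"
proof -
  let ?G = "\<lambda>x t. g (t *\<^sub>R x) + t *\<^sub>R g' (t *\<^sub>R x) x"
  have cont_g: "continuous_on UNIV g"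
    using g by (rule has_derivative_continuous_on)
  have "((\<lambda>x. integral (cbox 0 1) (\<lambda>t. g (t *\<^sub>R x) \<bullet> x)) has_derivative
      integral (cbox 0 1) (\<lambda>t. blinfun_inner_right (?G x t))) (at x within UNIV)"
  proof (rule leibniz_rule)
    show "(\<lambda>t. g (t *\<^sub>R x) \<bullet> x) integrable_on cbox 0 1" for x
      by (intro integrable_continuous continuous_intros continuous_on_compose2[OF cont_g]) auto
    show "continuous_on (UNIV \<times> cbox 0 1) (\<lambda>(x, t). blinfun_inner_right (?G x t))"
      unfolding split_beta
      by (intro continuous_intros bounded_linear.continuous_on[OF bounded_linear_blinfun_inner_right]
          continuous_on_compose2[OF cont_g] continuous_on_compose2[OF cont]) auto
  qed (use has_derivative_inner_along_ray[OF g sym] in auto)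
  moreover have "integral {0..1} (\<lambda>t. blinfun_inner_right (?G x t)) = blinfun_inner_right (g x)"
    using has_integral_linear[OF has_integral_derivative_along_ray[OF g]
      bounded_linear_blinfun_inner_right]
    unfolding comp_def by (rule integral_unique)
  ultimately show ?thesis by simp
qed

lemma constant_outside_compact_support:
  fixes f :: "'a::euclidean_space \<Rightarrow> real" and g :: "'a \<Rightarrow> 'a"
  assumes dim: "2 \<le> DIM('a)"
    and f: "\<And>x. (f has_derivative (\<lambda>h. g x \<bullet> h)) (at x)" and supp: "bounded {x. g x \<noteq> 0}"
  shows "\<exists>c. bounded {x. f x \<noteq> c}"
proof -
  obtain R where R: "\<And>x. g x \<noteq> 0 \<Longrightarrow> norm x \<le> R"
    using supp unfolding bounded_iff by blast
  let ?S = "- cball (0::'a) R"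
  have "f constant_on ?S"
  proof (rule has_derivative_zero_connected_constant_on)
    show "connected ?S" by (rule connected_complement_bounded_convex) (use dim in auto)
    show "continuous_on ?S f"
      by (rule has_derivative_continuous_on[OF has_derivative_at_withinI[OF f]])
    show "\<forall>x\<in>?S - {}. (f has_derivative (\<lambda>h. 0)) (at x within ?S)"
    proof
      fix x assume "x \<in> ?S - {}"
      then have "g x = 0" using R[of x] by force
      then show "(f has_derivative (\<lambda>h. 0)) (at x within ?S)"
        using has_derivative_at_withinI[OF f[of x]] by simp
    qed
  qed auto
  then obtain c where "\<And>x. x \<in> ?S \<Longrightarrow> f x = c" unfolding constant_on_def by blast
  then have "{x. f x \<noteq> c} \<subseteq> cball 0 R" by blast
  then show ?thesis using bounded_subset[OF bounded_cball] by blast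
qed

lemma differentiable_vec_nth:
  fixes u :: "real^'n \<Rightarrow> real^'m"
  assumes "\<And>i. (\<lambda>x. u x $ i) differentiable at x"
  shows "u differentiable at x"
  using assms unfolding differentiable_componentwise_within[of u x UNIV]
  by (auto simp: Basis_vec_def inner_axis)

lemma jacobian_nth:
  fixes u :: "real^'n \<Rightarrow> real^'m"
  assumes "\<And>i. (\<lambda>x. u x $ i) differentiable at x"
  shows "jacobian u (at x) $ i $ j = \<partial> j (\<lambda>x. u x $ i) x"
proof -
  have "(u has_derivative (*v) (jacobian u (at x))) (at x)"
    using differentiable_vec_nth[OF assms] by (simp add: jacobian_works)
  then have "((\<lambda>x. u x $ i) has_derivative (\<lambda>h. (jacobian u (at x) *v h) $ i)) (at x)"
    by (rule bounded_linear.has_derivative[OF bounded_linear_vec_nth])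
  from partial_deriv_eqI[OF this, of j] show ?thesis
    by (simp add: matrix_vector_mult_basis column_def)
qed

lemma ex_compactly_supported_potential:
  fixes g :: "real^'n \<Rightarrow> real^'n"
  assumes dim: "2 \<le> CARD('n)" and C1: "\<And>i. Ck_scalar 1 (\<lambda>x. g x $ i)"
    and closed: "\<And>i j x. \<partial> i (\<lambda>x. g x $ j) x = \<partial> j (\<lambda>x. g x $ i) x" and supp: "bounded {x. g x \<noteq> 0}"
  shows "\<exists>f. (\<forall>x. f differentiable at x) \<and> (\<forall>i. \<partial> i f = (\<lambda>x. g x $ i)) \<and> bounded {x. f x \<noteq> 0}"
proof -
  define g' where "g' x = Blinfun ((*v) (jacobian g (at x)))" for x
  have g'_apply: "blinfun_apply (g' x) = (*v) (jacobian g (at x))" for x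
    by (simp add: g'_def bounded_linear_Blinfun_apply)
  note jac = jacobian_nth[OF Ck_scalar_1D(1)[OF C1]]
  have "(g has_derivative g' x) (at x)" for x
    using differentiable_vec_nth[OF Ck_scalar_1D(1)[OF C1]] by (simp add: g'_apply jacobian_works)
  moreover have "continuous_on UNIV g'"
  proof (rule continuous_on_blinfun_componentwise)
    fix b :: "real^'n" assume "b \<in> Basis"
    then obtain j where "b = axis j 1" by (auto simp: Basis_vec_def)
    then have "g' x b = (\<chi> i. \<partial> j (\<lambda>x. g x $ i) x)" for x
      by (simp add: g'_apply matrix_vector_mult_basis column_def jac)
    then show "continuous_on UNIV (\<lambda>x. g' x b)"
      using Ck_scalar_1D(2)[OF C1] by (simp add: continuous_on_vec_lambda)
  qed
  moreover have "g' x h \<bullet> k = g' x k \<bullet> h" for x h k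
  proof -
    have "transpose (jacobian g (at x)) = jacobian g (at x)"
      by (simp add: vec_eq_iff transpose_def jac closed)
    then show ?thesis
      unfolding g'_apply by (metis dot_lmul_matrix inner_commute vector_transpose_matrix)
  qed
  ultimately obtain f where f: "\<And>x. (f has_derivative (\<lambda>h. g x \<bullet> h)) (at x)"
    using has_derivative_ray_integral[of g g'] by blast
  obtain c where c: "bounded {x. f x \<noteq> c}"
    using constant_outside_compact_support[OF _ f supp] dim by auto
  have deriv: "((\<lambda>x. f x - c) has_derivative (\<lambda>h. g x \<bullet> h)) (at x)" for x
    using has_derivative_diff[OF f has_derivative_const] by simp
  have "\<partial> i (\<lambda>x. f x - c) = (\<lambda>x. g x $ i)" for i
    by (simp add: fun_eq_iff partial_deriv_eqI[OF deriv] inner_axis)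
  then show ?thesis using deriv c unfolding differentiable_def
    by (intro exI[of _ "\<lambda>x. f x - c"]) auto
qed

definition perp_gradient :: "(real^2 \<Rightarrow> real) \<Rightarrow> real^2 \<Rightarrow> real^2" where
  "perp_gradient f x = vector [\<partial> 2 f x, - \<partial> 1 f x]"

lemma perp_gradient_nth [simp]:
  "perp_gradient f x $ 1 = \<partial> 2 f x" "perp_gradient f x $ 2 = - \<partial> 1 f x"
  by (simp_all add: perp_gradient_def)

lemma perp_gradient_eq_0_iff: "perp_gradient f x = 0 \<longleftrightarrow> (\<forall>i. \<partial> i f x = 0)"
  by (auto simp: vec_eq_iff forall_2)

lemma Ck_perp_gradient: "Ck_scalar (Suc k) f \<Longrightarrow> Ck k (perp_gradient f)"
  by (simp add: Ck_def forall_2 Ck_scalar_Suc Ck_scalar_minus)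

lemma jacobian_perp_gradient:
  assumes "Ck_scalar 2 f"
  shows "jacobian (perp_gradient f) (at x) =
    vector [vector [\<partial> 1 (\<partial> 2 f) x, \<partial> 2 (\<partial> 2 f) x], vector [- \<partial> 1 (\<partial> 1 f) x, - \<partial> 2 (\<partial> 1 f) x]]"
proof -
  have diff: "\<forall>i. (\<lambda>x. perp_gradient f x $ i) differentiable at x"
    using Ck_scalar_2D(2)[OF assms] by (simp add: forall_2)
  show ?thesis
    by (simp add: vec_eq_iff forall_2 jacobian_nth[OF diff[rule_format]] partial_deriv_minus
        Ck_scalar_2D[OF assms])
qed

lemma jacobian_perp_gradient_eq_0_iff:
  "Ck_scalar 2 f \<Longrightarrow> jacobian (perp_gradient f) (at x) = 0 \<longleftrightarrow> (\<forall>i j. \<partial> i (\<partial> j f) x = 0)"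
  by (auto simp: jacobian_perp_gradient vec_eq_iff forall_2)

lemma divergence_perp_gradient: "Ck_scalar 2 f \<Longrightarrow> divergence (perp_gradient f) x = 0"
  by (simp add: divergence_def trace_def sum_2 jacobian_perp_gradient partial_deriv_commute)

lemma compact_supp_perp_gradient:
  assumes "bounded {x. f x \<noteq> 0}"
  shows "compact (supp (perp_gradient f))"
proof -
  have "{x. perp_gradient f x \<noteq> 0} = (\<Union>i. {x. \<partial> i f x \<noteq> 0})"
    by (auto simp: perp_gradient_eq_0_iff)
  then have "bounded {x. perp_gradient f x \<noteq> 0}"
    using bounded_support_partial_deriv[OF assms] by (simp add: bounded_UN)
  then show ?thesis by (simp add: supp_def)
qed

lemma supp_perp_gradient_disjoint:
  assumes "locally_constant_near K f"
  shows "supp (perp_gradient f) \<subseteq> - K"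
proof -
  obtain U where "open U" "K \<subseteq> U" "\<And>x i. x \<in> U \<Longrightarrow> \<partial> i f x = 0"
    using assms unfolding locally_constant_near_def by blast
  moreover from this have "supp (perp_gradient f) \<subseteq> - U"
    unfolding supp_def by (intro closure_minimal) (auto simp: perp_gradient_eq_0_iff)
  ultimately show ?thesis by blast
qed

lemma ex_stream_function:
  fixes u :: "real^2 \<Rightarrow> real^2"
  assumes u: "Ck (Suc k) u" and supp: "compact (supp u)" and div: "\<And>x. divergence u x = 0"
  shows "\<exists>\<psi>. Ck_scalar (Suc (Suc k)) \<psi> \<and> bounded {x. \<psi> x \<noteq> 0} \<and> perp_gradient \<psi> = u"
proof -
  define g :: "real^2 \<Rightarrow> real^2" where "g x = vector [- u x $ 2, u x $ 1]" for x
  have g_nth: "g x $ 1 = - u x $ 2" "g x $ 2 = u x $ 1" for x by (simp_all add: g_def)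
  have u_nth: "Ck_scalar (Suc k) (\<lambda>x. u x $ i)" for i using u by (simp add: Ck_def)
  have g: "Ck_scalar (Suc k) (\<lambda>x. g x $ i)" for i
  proof -
    have "\<forall>i. Ck_scalar (Suc k) (\<lambda>x. g x $ i)"
      unfolding forall_2 g_nth using u_nth Ck_scalar_minus by blast
    then show ?thesis ..
  qed
  have diff: "(\<lambda>x. u x $ i) differentiable at x" for i x using u_nth by (simp add: Ck_scalar_Suc)
  have "\<partial> 1 (\<lambda>x. u x $ 1) x + \<partial> 2 (\<lambda>x. u x $ 2) x = 0" for x
    using div[of x] by (simp add: divergence_def trace_def sum_2 jacobian_nth[OF diff])
  then have "\<forall>i j. \<partial> i (\<lambda>x. g x $ j) x = \<partial> j (\<lambda>x. g x $ i) x" for x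
    unfolding forall_2 g_nth by (simp add: partial_deriv_minus diff add_eq_0_iff)
  moreover have "bounded {x. g x \<noteq> 0}"
  proof (rule bounded_subset[OF compact_imp_bounded[OF supp]])
    show "{x. g x \<noteq> 0} \<subseteq> supp u"
      unfolding supp_def using closure_subset by (fastforce simp: vec_eq_iff forall_2 g_nth)
  qed
  ultimately obtain \<psi> where \<psi>: "\<And>x. \<psi> differentiable at x" "\<And>i. \<partial> i \<psi> = (\<lambda>x. g x $ i)"
    "bounded {x. \<psi> x \<noteq> 0}"
    using ex_compactly_supported_potential[of g] Ck_scalar_mono[OF g, of 1] by auto
  have "perp_gradient \<psi> = u" by (auto simp: fun_eq_iff vec_eq_iff forall_2 \<psi>(2) g_nth)
  moreover have "Ck_scalar (Suc (Suc k)) \<psi>" unfolding Ck_scalar_Suc[of "Suc k"] using \<psi>(1,2) g by simp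
  ultimately show ?thesis using \<psi>(3) by blast
qed

section \<open>Approximation of solenoidal fields\<close>

lemma norm_matrix_le_sum_abs:
  fixes A :: "real^'n^'m"
  shows "norm A \<le> (\<Sum>i\<in>UNIV. \<Sum>j\<in>UNIV. \<bar>A $ i $ j\<bar>)"
proof -
  have "norm A \<le> (\<Sum>i\<in>UNIV. norm (A $ i))"
    unfolding norm_vec_def[of A] by (rule L2_set_le_sum) simp
  also have "\<dots> \<le> (\<Sum>i\<in>UNIV. \<Sum>j\<in>UNIV. \<bar>A $ i $ j\<bar>)"
    by (intro sum_mono norm_le_l1_cart)
  finally show ?thesis .
qed

lemma dist_perp_gradient_le:
  assumes C2: "Ck_scalar 2 f" "Ck_scalar 2 g" and close: "jet_bound 1 \<epsilon> (\<lambda>x. f x - g x) x"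
  shows "dist (perp_gradient f x) (perp_gradient g x) \<le> 4 * \<epsilon>"
    and "dist (jacobian (perp_gradient f) (at x)) (jacobian (perp_gradient g) (at x)) \<le> 4 * \<epsilon>"
proof -
  note diff = Ck_scalar_2D(1,2)[OF C2(1)] Ck_scalar_2D(1,2)[OF C2(2)]
  have first_eq: "\<partial> i (\<lambda>x. f x - g x) = (\<lambda>x. \<partial> i f x - \<partial> i g x)" for i
    by (rule ext) (simp add: partial_deriv_diff diff)
  have first: "\<bar>\<partial> i f x - \<partial> i g x\<bar> \<le> \<epsilon>" for i
    using jet_boundD(2)[OF close, of i] by (simp add: first_eq)
  have second: "\<bar>\<partial> i (\<partial> j f) x - \<partial> i (\<partial> j g) x\<bar> \<le> \<epsilon>" for i j
    using jet_boundD(3)[OF close, of i j] by (simp add: first_eq partial_deriv_diff diff)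
  have "norm (perp_gradient f x - perp_gradient g x) \<le> \<bar>\<partial> 2 f x - \<partial> 2 g x\<bar> + \<bar>\<partial> 1 f x - \<partial> 1 g x\<bar>"
    using norm_le_l1_cart[of "perp_gradient f x - perp_gradient g x"]
    by (simp add: sum_2 abs_minus_commute)
  then show "dist (perp_gradient f x) (perp_gradient g x) \<le> 4 * \<epsilon>"
    using first[of 1] first[of 2] jet_bound_nonneg[OF close] unfolding dist_norm by linarith
  show "dist (jacobian (perp_gradient f) (at x)) (jacobian (perp_gradient g) (at x)) \<le> 4 * \<epsilon>"
    using norm_matrix_le_sum_abs[of
        "jacobian (perp_gradient f) (at x) - jacobian (perp_gradient g) (at x)"]
      second[of 1 1] second[of 1 2] second[of 2 1] second[of 2 2]
    unfolding dist_norm by (simp add: sum_2 jacobian_perp_gradient C2 abs_minus_commute)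
qed

lemma uniform_limit_of_dist_le:
  assumes "\<And>n x. x \<in> S \<Longrightarrow> dist (f n x) (l x) \<le> b n" and b: "(b \<longlongrightarrow> (0::real)) F"
  shows "uniform_limit S f l F"
proof (rule uniform_limitI)
  fix e :: real assume "0 < e"
  with b have "\<forall>\<^sub>F n in F. b n < e" by (rule order_tendstoD)
  then show "\<forall>\<^sub>F n in F. \<forall>x\<in>S. dist (f n x) (l x) < e"
    by eventually_elim (use assms(1) le_less_trans in blast)
qed

lemma ex_solenoidal_approx:
  fixes u :: "real^2 \<Rightarrow> real^2"
  assumes K: "bounded K" and u: "Ck 2 u" "compact (supp u)" "\<And>x. divergence u x = 0"
    and zero: "\<And>x. x \<in> K \<Longrightarrow> u x = 0" "\<And>x. x \<in> K \<Longrightarrow> jacobian u (at x) = 0" and \<epsilon>: "0 < \<epsilon>"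
  shows "\<exists>v. C_infinity v \<and> compact (supp v) \<and> (\<forall>x. divergence v x = 0) \<and> supp v \<subseteq> UNIV - K \<and>
    (\<forall>x. dist (v x) (u x) \<le> \<epsilon>) \<and> (\<forall>x. dist (jacobian v (at x)) (jacobian u (at x)) \<le> \<epsilon>)"
proof -
  obtain \<psi> where \<psi>: "Ck_scalar 3 \<psi>" "bounded {x. \<psi> x \<noteq> 0}" and u_eq: "perp_gradient \<psi> = u"
    using ex_stream_function[of 1 u] u by (auto simp: numeral_2_eq_2 numeral_3_eq_3)
  have C2: "Ck_scalar 2 \<psi>" using \<psi>(1) by (rule Ck_scalar_mono) simp
  have crit: "\<partial> i \<psi> y = 0" "\<partial> i (\<partial> j \<psi>) y = 0" if "y \<in> K" for y i j
    using zero that jacobian_perp_gradient_eq_0_iff[OF C2]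
    by (auto simp: perp_gradient_eq_0_iff simp flip: u_eq)
  obtain L where lip: "lipschitz_hessian L \<psi>" using ex_lipschitz_hessian_compact_support[OF \<psi>] by blast
  have "0 < \<epsilon> / 4" using \<epsilon> by simp
  from ex_approx_locally_constant_near[OF _ C2 lip \<psi>(2) K crit this]
  obtain g where g: "smooth g" "bounded {x. g x \<noteq> 0}" "locally_constant_near K g"
    and close: "\<And>x. jet_bound 1 (\<epsilon> / 4) (\<lambda>x. g x - \<psi> x) x" by auto
  note dist_le = dist_perp_gradient_le[OF g(1)[rule_format] C2 close, unfolded u_eq]
  show ?thesis
    using dist_le g Ck_perp_gradient compact_supp_perp_gradient divergence_perp_gradient
      supp_perp_gradient_disjoint
    by (intro exI[of _ "perp_gradient g"]) (simp add: C_infinity_def flip: Compl_eq_Diff_UNIV)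
qed

theorem theorem1p4:
  fixes K :: "(real^2) set" and u :: "real^2 \<Rightarrow> real^2"
  assumes "compact K"
    and "Ck 2 u" and "compact (supp u)"
    and "\<forall>x. divergence u x = 0"
    and "\<forall>x\<in>K. u x = 0"
    and "\<forall>x\<in>K. jacobian u (at x) = 0"
  shows "\<exists>uk :: nat \<Rightarrow> real^2 \<Rightarrow> real^2.
           (\<forall>k. C_infinity (uk k) \<and> compact (supp (uk k))
                \<and> (\<forall>x. divergence (uk k) x = 0)
                \<and> supp (uk k) \<subseteq> UNIV - K)
         \<and> uniform_limit UNIV uk u sequentially
         \<and> uniform_limit UNIV (\<lambda>k x. jacobian (uk k) (at x)) (\<lambda>x. jacobian u (at x)) sequentially"
proof -
  have "\<forall>k. \<exists>v. C_infinity v \<and> compact (supp v) \<and> (\<forall>x. divergence v x = 0) \<and> supp v \<subseteq> UNIV - K \<and>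
      (\<forall>x. dist (v x) (u x) \<le> inverse (real (Suc k))) \<and>
      (\<forall>x. dist (jacobian v (at x)) (jacobian u (at x)) \<le> inverse (real (Suc k)))"
    using assms by (intro allI ex_solenoidal_approx compact_imp_bounded) auto
  from choice[OF this] obtain uk where uk: "\<forall>k. C_infinity (uk k) \<and> compact (supp (uk k))
      \<and> (\<forall>x. divergence (uk k) x = 0) \<and> supp (uk k) \<subseteq> UNIV - K"
    and close: "\<And>k x. dist (uk k x) (u x) \<le> inverse (real (Suc k))"
      "\<And>k x. dist (jacobian (uk k) (at x)) (jacobian u (at x)) \<le> inverse (real (Suc k))"
    by blast
  have "uniform_limit UNIV uk u sequentially"
    "uniform_limit UNIV (\<lambda>k x. jacobian (uk k) (at x)) (\<lambda>x. jacobian u (at x)) sequentially"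
    by (rule uniform_limit_of_dist_le[OF _ LIMSEQ_inverse_real_of_nat], rule close)+
  with uk show ?thesis by blast
qed

end
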